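(* Let $\lambda\ge 0$, let $E=\{x_1,x_2,\dots,x_n\}\subset SG$ be a finite set of ($n$ distinct) points, and let $a_1,\dots,a_n\in\mathbb{R}$ be given. Then there exist unique constants $c_1,\dots,c_n\in\mathbb{R}$ such that the function $f(x)=\sum_{i=1}^n c_i\,G_\lambda(x,x_i)$ satisfies $f(x_i)=a_i$ for all $i$. Furthermore, this function $f$ is the unique minimizer of $\mathcal{E}_\lambda(u)=\mathcal{E}(u)+\lambda\int_{SG}u^2\,d\mu$ among all $u\in\operatorname{dom}\mathcal{E}_0$ with $u(x_i)=a_i$ for all $i$.
   Context: Let $q_0,q_1,q_2$ be the vertices of an equilateral triangle in the plane, $F_i(x)=\frac12(x+q_i)$, and let $SG$ (the Sierpinski gasket) be the unique nonempty compact set with $SG=\bigcup_{i}F_i(SG)$. For a word $w=w_1\cdots w_m$ let $F_w=F_{w_1}\circ\cdots\circ F_{w_m}$. Put $V_0=\{q_0,q_1,q_2\}$, $V_m=\bigcup_iF_iV_{m-1}$; $x\sim_m y$ means $x\ne y$ and $x,y\in F_wV_0$ for some word $w$ of length $m$. The energy of a continuous $u:SG\to\mathbb{R}$ is $\mathcal{E}(u)=\lim_{m\to\infty}\left(\frac53\right)^m\sum_{\{x,y\}:x\sim_m y}(u(x)-u(y))^2$ (a nondecreasing limit), $\operatorname{dom}\mathcal{E}$ is the set of continuous $u$ with $\mathcal{E}(u)<\infty$, and $\mathcal{E}(u,v)$ is the associated bilinear form. $\operatorname{dom}\mathcal{E}_0=\{u\in\operatorname{dom}\mathcal{E}: u|_{V_0}=0\}$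 (Dirichlet boundary conditions). $\mu$ is the standard self-similar probability measure, $\mu(F_w SG)=3^{-|w|}$. For $\lambda\ge0$, $G_\lambda$ is the kernel of the Dirichlet resolvent $(\lambda-\Delta_\mu)^{-1}$ of the Laplacian $\Delta_\mu$ (the Green's function when $\lambda=0$): for each $y\in SG$, $G_\lambda(\cdot,y)$ is the unique element of $\operatorname{dom}\mathcal{E}_0$ such that $\mathcal{E}(G_\lambda(\cdot,y),v)+\lambda\int_{SG} G_\lambda(\cdot,y)\,v\,d\mu=v(y)$ for all $v\in\operatorname{dom}\mathcal{E}_0$; $G_\lambda$ is symmetric.
   Formalization: The points x_i are required to lie in SG \ V_0: if some x_j is in V_0 then G_λ(·,x_j)=0, so c_j is never unique and f(x_j)=0 for every choice of constants, and the claim as stated fails. *)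

theory Defs
  imports "HOL-Analysis.Analysis" "HOL-Probability.Probability"
begin

text \<open>The index set of the three contractions is the three-element type \<open>3\<close>, so words
  over it are arbitrary elements of \<open>3 list\<close>.\<close>

definition equilateral :: "(3 \<Rightarrow> real^2) \<Rightarrow> bool" where
  "equilateral q \<longleftrightarrow> (\<exists>d>0. \<forall>i j. i \<noteq> j \<longrightarrow> dist (q i) (q j) = d)"

definition F :: "(3 \<Rightarrow> real^2) \<Rightarrow> 3 \<Rightarrow> real^2 \<Rightarrow> real^2" where
  "F q i x = (1/2) *\<^sub>R (x + q i)"

primrec Fw :: "(3 \<Rightarrow> real^2) \<Rightarrow> 3 list \<Rightarrow> real^2 \<Rightarrow> real^2" where
  "Fw q [] = id"
| "Fw q (i # w) = F q i \<circ> Fw q w"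

definition SG :: "(3 \<Rightarrow> real^2) \<Rightarrow> (real^2) set" where
  "SG q = (THE K. compact K \<and> K \<noteq> {} \<and> K = (\<Union>i. F q i ` K))"

definition V0 :: "(3 \<Rightarrow> real^2) \<Rightarrow> (real^2) set" where
  "V0 q = range q"

definition adj :: "(3 \<Rightarrow> real^2) \<Rightarrow> nat \<Rightarrow> real^2 \<Rightarrow> real^2 \<Rightarrow> bool" where
  "adj q m x y \<longleftrightarrow> x \<noteq> y \<and> (\<exists>w. length w = m \<and> x \<in> Fw q w ` V0 q \<and> y \<in> Fw q w ` V0 q)"

text \<open>The sum runs over ordered pairs, so every edge occurs twice; hence the factor 1/2.\<close>

definition graph_energy :: "(3 \<Rightarrow> real^2) \<Rightarrow> nat \<Rightarrow> (real^2 \<Rightarrow> real) \<Rightarrow> real" where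
  "graph_energy q m u =
     (5/3)^m * ((1/2) * (\<Sum>(x, y)\<in>{(x, y). adj q m x y}. (u x - u y)\<^sup>2))"

definition energy :: "(3 \<Rightarrow> real^2) \<Rightarrow> (real^2 \<Rightarrow> real) \<Rightarrow> ennreal" where
  "energy q u = lim (\<lambda>m. ennreal (graph_energy q m u))"

text \<open>A function on the gasket is represented by its extension by zero to the plane. This makes
  equality of representatives the same as equality on the gasket.\<close>

definition domE :: "(3 \<Rightarrow> real^2) \<Rightarrow> (real^2 \<Rightarrow> real) set" where
  "domE q = {u. continuous_on (SG q) u \<and> (\<forall>x. x \<notin> SG q \<longrightarrow> u x = 0) \<and> energy q u < \<infinity>}"

definition domE0 :: "(3 \<Rightarrow> real^2) \<Rightarrow> (real^2 \<Rightarrow> real) set" where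
  "domE0 q = {u \<in> domE q. \<forall>x\<in>V0 q. u x = 0}"

text \<open>The bilinear form associated with the energy, by polarization; meant for arguments
  in \<^term>\<open>domE q\<close>, where both energies are finite.\<close>

definition energy_form ::
    "(3 \<Rightarrow> real^2) \<Rightarrow> (real^2 \<Rightarrow> real) \<Rightarrow> (real^2 \<Rightarrow> real) \<Rightarrow> real" where
  "energy_form q u v =
     (enn2real (energy q (\<lambda>x. u x + v x)) - enn2real (energy q (\<lambda>x. u x - v x))) / 4"

text \<open>The self-similar probability measure, as a Borel measure on the plane; the empty word
  shows that it is carried by the gasket.\<close>

definition SG_measure :: "(3 \<Rightarrow> real^2) \<Rightarrow> (real^2) measure" where
  "SG_measure q = (THE M. sets M = sets borel \<and> prob_space M \<and>
     (\<forall>w. measure M (Fw q w ` SG q) = (1/3) ^ length w))"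

definition energy_lam :: "(3 \<Rightarrow> real^2) \<Rightarrow> real \<Rightarrow> (real^2 \<Rightarrow> real) \<Rightarrow> real" where
  "energy_lam q lam u =
     enn2real (energy q u) + lam * (LINT x:SG q|SG_measure q. (u x)\<^sup>2)"

text \<open>The kernel \<open>G\<^sub>\<lambda>(x, y)\<close>. For \<open>y\<close> in \<^term>\<open>V0 q\<close> the defining
  identity forces \<open>G\<^sub>\<lambda>(\<cdot>, y) = 0\<close>.\<close>

definition resolvent_kernel :: "(3 \<Rightarrow> real^2) \<Rightarrow> real \<Rightarrow> real^2 \<Rightarrow> real^2 \<Rightarrow> real" where
  "resolvent_kernel q lam x y =
     (THE g. g \<in> domE0 q \<and>
        (\<forall>v\<in>domE0 q.
           energy_form q g v + lam * (LINT z:SG q|SG_measure q. g z * v z) = v y)) x"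

end

theory Submission
  imports Defs
begin

text \<open>On the functions of finite energy that vanish on the corners, the sum of the energy form and
  \<open>\<lambda>\<close> times the \<open>L\<^sup>2\<close> product is a complete form that dominates the supremum norm, since
  \<open>\<bar>u x\<bar> \<le> 5 sqrt (\<E> u)\<close>. Minimizing sequences for prescribed values at finitely many points
  are therefore Cauchy, and the orthogonality of the minimizer \<open>v\<close> to functions vanishing at these
  points says that \<open>\<E>\<^sub>\<lambda> v w\<close> is a combination of the values \<open>w x\<^sub>i\<close>. One point gives the kernels,
  several points give the interpolating combination. What remains is a supply of functions
  of finite energy: harmonic functions separate the points of the gasket, and their products take
  the value 1 at one point and 0 at finitely many others.\<close>

section \<open>Geometry of the gasket\<close>

text \<open>\<open>SG\<close>, \<open>SG_measure\<close> and \<open>resolvent_kernel\<close> are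
  definite descriptions, so existence and uniqueness have to be settled before any of them can be
  used. This is why the gasket is rebuilt as an explicit intersection and why the measure receives a
  part of its own. The recurring method is induction on the first letter of a word: split into three
  cells and rescale. Its obstacle is that the cells are not disjoint. Two of them meet in a single
  junction point (\<open>overlap\<close>), so it must be checked each time that they share no edge
  and no mass, and that a function defined cell by cell has one value there. The Hilbert space
  argument is isolated in a locale about sets of functions. The nodes enter it through a dual
  family, with value 1 at one node and 0 at the others, and \<lambda> is dealt with beforehand by
  comparing the two forms (\<open>resolvent_form_bounds\<close>).\<close>

lemma F_dist: "dist (F q i x) (F q i y) = dist x y / 2"
proof -
  have "F q i x - F q i y = (1/2) *\<^sub>R (x - y)"
    by (simp add: F_def algebra_simps)
  then show ?thesis
    by (simp add: dist_norm)
qed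

lemma F_eq_iff [simp]: "F q i x = F q i y \<longleftrightarrow> x = y"
  using F_dist[of q i x y] by (metis dist_eq_0_iff divide_eq_0_iff zero_neq_numeral)

lemma F_fixed [simp]: "F q i (q i) = q i"
  by (simp add: F_def scaleR_2 [symmetric])

lemma F_corner_commute: "F q i (q j) = F q j (q i)"
  by (simp add: F_def add.commute)

lemma continuous_on_F: "continuous_on A (F q i)"
  unfolding F_def by (intro continuous_intros)

lemma F_inverse: "F q i (2 *\<^sub>R x - q i) = x"
  by (simp add: F_def)

lemma Fw_append: "Fw q (v @ w) = Fw q v \<circ> Fw q w"
  by (induction v) (auto simp: o_assoc)

lemma Fw_dist: "dist (Fw q w x) (Fw q w y) = dist x y / 2 ^ length w"
  by (induction w) (auto simp: F_dist field_simps)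

lemma continuous_on_Fw: "continuous_on A (Fw q w)"
proof (induction w arbitrary: A)
  case (Cons i w)
  then show ?case
    unfolding Fw.simps by (intro continuous_on_compose continuous_on_F)
qed (simp add: id_def)

locale gasket =
  fixes q :: "3 \<Rightarrow> real^2"
  assumes equilateral: "equilateral q"
begin

section \<open>Barycentric coordinates and the closed triangle\<close>

definition side :: real where
  "side = dist (q 1) (q 2)"

lemma side_pos: "side > 0"
proof -
  have "(1::3) \<noteq> 2" by simp
  then show ?thesis
    using equilateral unfolding equilateral_def side_def by metis
qed

lemma dist_corners: "i \<noteq> j \<Longrightarrow> dist (q i) (q j) = side"
proof -
  assume "i \<noteq> j"
  moreover have "(1::3) \<noteq> 2" by simp
  ultimately show ?thesis
    using equilateral unfolding equilateral_def side_def by metis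
qed

text \<open>Barycentric coordinate at the corner \<open>q i\<close>. The sum of the vectors
  \<open>q i - q j\<close> points along the altitude through \<open>q i\<close>, and its inner
  product with \<open>q k - q i\<close> is -3/2 times the squared side for k \<noteq> i; the factor
  makes the coordinate drop from 1 to 0.\<close>

definition bary :: "3 \<Rightarrow> real^2 \<Rightarrow> real" where
  "bary i x = 1 + (2 / (3 * side\<^sup>2)) * ((x - q i) \<bullet> (\<Sum>j\<in>UNIV. q i - q j))"

lemma inner_corners_same: "i \<noteq> j \<Longrightarrow> (q i - q j) \<bullet> (q i - q j) = side\<^sup>2"
  using dist_corners[of i j] by (simp add: dist_norm power2_norm_eq_inner[symmetric])

text \<open>Law of cosines: expand the squared third side and solve for the mixed term.\<close>

lemma inner_corners:
  assumes "k \<noteq> i" "i \<noteq> l" "k \<noteq> l"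
  shows "(q k - q i) \<bullet> (q i - q l) = - side\<^sup>2 / 2"
proof -
  have "(q k - q l) \<bullet> (q k - q l) =
      (q k - q i) \<bullet> (q k - q i) + (q i - q l) \<bullet> (q i - q l) + 2 * ((q k - q i) \<bullet> (q i - q l))"
    by (simp add: inner_diff_left inner_diff_right inner_commute)
  then show ?thesis
    using assms inner_corners_same by simp
qed

lemma bary_corner: "bary i (q k) = (if i = k then 1 else 0)"
proof (cases "i = k")
  case False
  obtain l where l: "l \<noteq> i" "l \<noteq> k" "UNIV = {i, k, l}"
  proof -
    have "\<forall>i k::3. i \<noteq> k \<longrightarrow> (\<exists>l. l \<noteq> i \<and> l \<noteq> k \<and> (\<forall>m. m = i \<or> m = k \<or> m = l))"
    proof -
      have "(\<exists>l. P l) \<longleftrightarrow> P 1 \<or> P 2 \<or> P 3" for P :: "3 \<Rightarrow> bool"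
        by (metis exhaust_3)
      then show ?thesis by (simp add: forall_3)
    qed
    then show ?thesis using that False by blast
  qed
  have "(q k - q i) \<bullet> (\<Sum>j\<in>UNIV. q i - q j) =
      (q k - q i) \<bullet> (q i - q k) + (q k - q i) \<bullet> (q i - q l)"
    unfolding l(3) using l(1,2) False by (simp add: inner_add_right[symmetric])
  also have "(q k - q i) \<bullet> (q i - q k) = - side\<^sup>2"
    using inner_corners_same[of k i] False
    by (metis inner_minus_right minus_diff_eq)
  also have "(q k - q i) \<bullet> (q i - q l) = - side\<^sup>2 / 2"
    using inner_corners[of k i l] l False by auto
  finally show ?thesis
    using False side_pos by (simp add: bary_def field_simps)
qed (simp add: bary_def)

lemma bary_F: "bary j (F q i x) = (bary j x + (if i = j then 1 else 0)) / 2"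
proof -
  have "bary j (F q i x) = (bary j x + bary j (q i)) / 2"
    unfolding bary_def F_def
    by (simp add: algebra_simps inner_add_left inner_diff_left add_divide_distrib)
  then show ?thesis
    by (simp add: bary_corner)
qed

lemma continuous_on_bary: "continuous_on A (bary i)"
  unfolding bary_def by (intro continuous_intros)

text \<open>Carrying the sum and the representation of \<open>x\<close> along lets both be
  propagated through the maps, with no dimension argument for the plane.\<close>

definition tri :: "(real^2) set" where
  "tri = {x. (\<forall>i. bary i x \<ge> 0) \<and> (\<Sum>i\<in>UNIV. bary i x) = 1 \<and> x = (\<Sum>i\<in>UNIV. bary i x *\<^sub>R q i)}"

lemma corner_in_tri: "q k \<in> tri"
  by (simp add: tri_def bary_corner if_distrib[of "\<lambda>t. t *\<^sub>R _"] cong: if_cong)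

lemma F_in_tri:
  assumes "x \<in> tri"
  shows "F q i x \<in> tri"
proof -
  have x: "x = bary 1 x *\<^sub>R q 1 + bary 2 x *\<^sub>R q 2 + bary 3 x *\<^sub>R q 3"
    using assms by (simp add: tri_def sum_3)
  have "F q i x = (\<Sum>j\<in>UNIV. bary j (F q i x) *\<^sub>R q j)"
  proof -
    have "F q i x = (1/2) *\<^sub>R ((bary 1 x *\<^sub>R q 1 + bary 2 x *\<^sub>R q 2 + bary 3 x *\<^sub>R q 3) + q i)"
      unfolding F_def using x by simp
    also have "\<dots> = (\<Sum>j\<in>UNIV. ((bary j x + (if i = j then 1 else 0)) / 2) *\<^sub>R q j)"
      using exhaust_3[of i] by (auto simp: sum_3 algebra_simps add_divide_distrib)
    finally show ?thesis unfolding bary_F .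
  qed
  moreover have "(\<Sum>j\<in>UNIV. bary j (F q i x)) = 1"
    using assms exhaust_3[of i] by (auto simp: bary_F sum_3 tri_def field_simps)
  moreover have "bary j (F q i x) \<ge> 0" for j
    using assms by (simp add: bary_F tri_def)
  ultimately show ?thesis
    unfolding tri_def by blast
qed

lemma compact_tri: "compact tri"
proof -
  have "closed tri"
  proof -
    have "tri = (\<Inter>i. {x. 0 \<le> bary i x}) \<inter> {x. (\<Sum>i\<in>UNIV. bary i x) = 1}
        \<inter> {x. x = (\<Sum>i\<in>UNIV. bary i x *\<^sub>R q i)}"
      by (auto simp: tri_def)
    moreover have "closed {x. 0 \<le> bary i x}" for i
      by (intro closed_Collect_le continuous_intros continuous_on_bary)
    moreover have "closed {x. (\<Sum>i\<in>UNIV. bary i x) = 1}"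
      by (intro closed_Collect_eq continuous_intros continuous_on_bary)
    moreover have "closed {x. x = (\<Sum>i\<in>UNIV. bary i x *\<^sub>R q i)}"
      by (intro closed_Collect_eq continuous_intros continuous_on_bary)
    ultimately show ?thesis by (simp add: closed_INT closed_Int)
  qed
  moreover have "bounded tri"
  proof -
    have "norm x \<le> (\<Sum>i\<in>UNIV. norm (q i))" if "x \<in> tri" for x
    proof -
      have b: "0 \<le> bary i x \<and> bary i x \<le> 1" for i
      proof -
        have "bary i x \<le> (\<Sum>i\<in>UNIV. bary i x)"
          using that by (intro member_le_sum) (auto simp: tri_def)
        then show ?thesis using that by (auto simp: tri_def)
      qed
      have "norm x = norm (\<Sum>i\<in>UNIV. bary i x *\<^sub>R q i)"
        using that by (simp add: tri_def)
      also have "\<dots> \<le> (\<Sum>i\<in>UNIV. norm (q i))"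
        using b by (intro sum_norm_le) (auto simp: mult_left_le_one_le)
      finally show ?thesis .
    qed
    then show ?thesis unfolding bounded_iff by blast
  qed
  ultimately show ?thesis by (simp add: compact_eq_bounded_closed)
qed

text \<open>One coordinate already exhausts the total 1, so the nonnegative others vanish.\<close>

lemma tri_corner:
  assumes "y \<in> tri" "bary j y \<ge> 1"
  shows "y = q j"
proof -
  have le: "bary j y + bary k y \<le> 1" if "k \<noteq> j" for k
  proof -
    have "(\<Sum>i\<in>{j,k}. bary i y) \<le> (\<Sum>i\<in>UNIV. bary i y)"
      using assms by (intro sum_mono2) (auto simp: tri_def)
    then show ?thesis using that assms by (simp add: tri_def)
  qed
  have b: "bary k y = (if k = j then 1 else 0)" for k
  proof (cases "k = j")
    case True
    obtain l where "l \<noteq> j" by (metis exhaust_3 num1_eq_iff zero_neq_one)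
    then have "bary j y + bary l y \<le> 1" "bary l y \<ge> 0"
      using le[of l] assms by (auto simp: tri_def)
    then show ?thesis using assms True by simp
  next
    case False
    have "0 \<le> bary k y" using assms by (auto simp: tri_def)
    then show ?thesis using le[OF False] assms False by simp
  qed
  have "y = (\<Sum>i\<in>UNIV. bary i y *\<^sub>R q i)" using assms by (simp add: tri_def)
  then show ?thesis
    by (simp add: b if_distrib[of "\<lambda>t. t *\<^sub>R _"] cong: if_cong)
qed

text \<open>Cell \<open>i\<close> lies where the j-th coordinate is at most 1/2, cell
  \<open>j\<close> where it is at least 1/2. A common point therefore comes from a point
  \<open>x\<close> whose j-th coordinate is at least 1, a corner.\<close>

lemma tri_overlap:
  assumes "F q i x = F q j y" "i \<noteq> j" "x \<in> tri" "y \<in> tri"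
  shows "x = q j" "y = q i"
proof -
  have *: "x = q j" if "F q i x = F q j y" "i \<noteq> j" "x \<in> tri" "y \<in> tri" for i j x y
  proof -
    have "bary j x / 2 = (bary j y + 1) / 2"
      using bary_F[of j i x] bary_F[of j j y] that by simp
    moreover have "bary j y \<ge> 0" using that by (simp add: tri_def)
    ultimately show ?thesis using tri_corner[of x j] that by simp
  qed
  show "x = q j" "y = q i" using * assms by metis+
qed

section \<open>The gasket as the intersection of a decreasing sequence\<close>

primrec pre_gasket :: "nat \<Rightarrow> (real^2) set" where
  "pre_gasket 0 = tri"
| "pre_gasket (Suc m) = (\<Union>i. F q i ` pre_gasket m)"

lemma pre_gasket_decreasing: "pre_gasket (Suc m) \<subseteq> pre_gasket m"
  by (induction m) (auto intro: F_in_tri, blast)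

lemma pre_gasket_antimono: "m \<le> n \<Longrightarrow> pre_gasket n \<subseteq> pre_gasket m"
  using pre_gasket_decreasing by (rule lift_Suc_antimono_le)

lemma compact_pre_gasket: "compact (pre_gasket m)"
  by (induction m) (auto simp: compact_tri intro!: compact_UN compact_continuous_image continuous_on_F)

lemma corner_in_pre_gasket: "q k \<in> pre_gasket m"
  by (induction m arbitrary: k) (auto simp: corner_in_tri intro: image_eqI[where f = "F q _", OF F_fixed[symmetric]])

lemma Inter_pre_gasket:
  defines "K \<equiv> \<Inter>m. pre_gasket m"
  shows "compact K" "K \<noteq> {}" "K = (\<Union>i. F q i ` K)"
proof -
  show "compact K"
    unfolding K_def by (intro compact_Inter) (auto simp: compact_pre_gasket)
  show "K \<noteq> {}"
    using corner_in_pre_gasket unfolding K_def by blast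
  show "K = (\<Union>i. F q i ` K)"
  proof
    show "(\<Union>i. F q i ` K) \<subseteq> K"
    proof safe
      fix i x assume "x \<in> K"
      then have "F q i x \<in> pre_gasket (Suc m)" for m
        by (auto simp: K_def)
      then show "F q i x \<in> K"
        using pre_gasket_decreasing by (fastforce simp: K_def)
    qed
    show "K \<subseteq> (\<Union>i. F q i ` K)"
    proof
      fix x assume x: "x \<in> K"
      \<comment> \<open>At each stage some index works, but it may change with the stage. If every
        index failed somewhere, all three would fail at the latest of these stages, because the
        stages decrease.\<close>
      have "\<exists>i. \<forall>m. x \<in> F q i ` pre_gasket m"
      proof (rule ccontr)
        assume "\<nexists>i. \<forall>m. x \<in> F q i ` pre_gasket m"
        then obtain m where m: "x \<notin> F q i ` pre_gasket (m i)" for i by metis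
        define M where "M = Max (range m)"
        have "x \<in> pre_gasket (Suc M)" using x by (auto simp: K_def simp del: pre_gasket.simps)
        then obtain i where "x \<in> F q i ` pre_gasket M" by auto
        moreover have "m i \<le> M" by (simp add: M_def)
        ultimately show False using m[of i] pre_gasket_antimono[of "m i" M] by blast
      qed
      then obtain i where i: "\<And>m. x \<in> F q i ` pre_gasket m" by blast
      obtain y where y: "x = F q i y" using F_inverse by metis
      then have "y \<in> pre_gasket m" for m using i[of m] by (auto simp del: pre_gasket.simps)
      then have "y \<in> K" by (simp add: K_def)
      then show "x \<in> (\<Union>i. F q i ` K)" using y by blast
    qed
  qed
qed

end

text \<open>Two invariant compact sets contain each other, because the largest distance from a point of
  one to the other would be halved by the maps.\<close>

lemma invariant_subset:
  assumes K: "compact K" "K \<noteq> {}" "K = (\<Union>i. F q i ` K)"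
    and L: "compact L" "L \<noteq> {}" "L = (\<Union>i. F q i ` L)"
  shows "K \<subseteq> L"
proof -
  have inv: "infdist (F q i x) L \<le> infdist x L / 2" for i x
  proof -
    obtain y where y: "y \<in> L" "infdist x L = dist x y"
      using infdist_attains_inf[of L x] L by (auto simp: compact_imp_closed)
    have "F q i y \<in> L" using y L(3) by blast
    then have "infdist (F q i x) L \<le> dist (F q i x) (F q i y)" by (rule infdist_le)
    then show ?thesis by (simp add: F_dist y)
  qed
  obtain x where x: "x \<in> K" "\<And>y. y \<in> K \<Longrightarrow> infdist y L \<le> infdist x L"
    using continuous_attains_sup[of K "\<lambda>x. infdist x L"] K(1,2)
      continuous_on_infdist[OF continuous_on_id, of K L] by (metis (no_types))
  obtain i y where "x = F q i y" "y \<in> K" using x(1) K(3) by blast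
  then have "infdist x L \<le> infdist x L / 2" using inv[of i y] x(2)[of y] by simp
  then have "infdist y L = 0" if "y \<in> K" for y
    using x(2)[OF that] infdist_nonneg[of y L] by linarith
  then show ?thesis
    using L in_closed_iff_infdist_zero[of L] by (auto simp: compact_imp_closed)
qed

context gasket
begin

lemma SG_eq: "SG q = (\<Inter>m. pre_gasket m)"
  unfolding SG_def
proof (rule the_equality)
  show "compact (\<Inter>m. pre_gasket m) \<and> (\<Inter>m. pre_gasket m) \<noteq> {} \<and>
      (\<Inter>m. pre_gasket m) = (\<Union>i. F q i ` (\<Inter>m. pre_gasket m))"
    using Inter_pre_gasket by blast
  fix K assume K: "compact K \<and> K \<noteq> {} \<and> K = (\<Union>i. F q i ` K)"
  show "K = (\<Inter>m. pre_gasket m)"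
  proof (rule antisym)
    show "K \<subseteq> (\<Inter>m. pre_gasket m)"
      by (rule invariant_subset[OF _ _ _ Inter_pre_gasket]) (use K in blast)+
    show "(\<Inter>m. pre_gasket m) \<subseteq> K"
      by (rule invariant_subset[OF Inter_pre_gasket]) (use K in blast)+
  qed
qed

lemma compact_SG: "compact (SG q)"
  and SG_invariant: "SG q = (\<Union>i. F q i ` SG q)"
  unfolding SG_eq using Inter_pre_gasket by blast+

lemma corner_in_SG [simp]: "q i \<in> SG q"
  using corner_in_pre_gasket by (auto simp: SG_eq)

lemma F_in_SG [simp]: "x \<in> SG q \<Longrightarrow> F q i x \<in> SG q"
  using SG_invariant by blast

lemma SG_cases:
  assumes "x \<in> SG q"
  obtains i y where "x = F q i y" "y \<in> SG q"
  using assms SG_invariant by blast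

lemma SG_subset_tri: "SG q \<subseteq> tri"
  using SG_eq pre_gasket.simps(1) by blast

lemma overlap:
  assumes "F q i x = F q j y" "i \<noteq> j" "x \<in> SG q" "y \<in> SG q"
  shows "x = q j" "y = q i"
  using tri_overlap[OF assms(1,2)] assms SG_subset_tri by blast+

text \<open>As \<open>q j = F q j (q j)\<close>, a second cell containing this corner would make
  \<open>overlap\<close> identify two corners.\<close>

lemma F_eq_corner:
  assumes "F q i x = q j" "x \<in> SG q"
  shows "i = j" "x = q j"
proof -
  show "i = j"
  proof (rule ccontr)
    assume "i \<noteq> j"
    then have "q j = q i" using overlap(2)[of i x j "q j"] assms by simp
    then show False using dist_corners[OF \<open>i \<noteq> j\<close>] side_pos by simp
  qed
  then show "x = q j" using assms by (metis F_eq_iff F_fixed)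
qed

lemma Fw_in_SG [simp]: "x \<in> SG q \<Longrightarrow> Fw q w x \<in> SG q"
  by (induction w) auto

lemma SG_eq_cells: "SG q = (\<Union>w\<in>{w. length w = m}. Fw q w ` SG q)"
proof (induction m)
  case (Suc m)
  have "SG q = (\<Union>i. F q i ` SG q)" by (rule SG_invariant)
  also have "\<dots> = (\<Union>i. F q i ` (\<Union>w\<in>{w. length w = m}. Fw q w ` SG q))"
    using Suc by simp
  also have "\<dots> = (\<Union>w\<in>{w. length w = Suc m}. Fw q w ` SG q)"
    by (force simp: length_Suc_conv)
  finally show ?case .
qed auto

lemma SG_bound:
  obtains D where "D > 0" "\<And>x y. x \<in> SG q \<Longrightarrow> y \<in> SG q \<Longrightarrow> dist x y \<le> D"
proof -
  have "bounded (SG q)" using compact_SG compact_imp_bounded by blast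
  then obtain D where "\<And>x y. x \<in> SG q \<Longrightarrow> y \<in> SG q \<Longrightarrow> dist x y \<le> D"
    by (auto simp: bounded_two_points)
  then have "\<And>x y. x \<in> SG q \<Longrightarrow> y \<in> SG q \<Longrightarrow> dist x y \<le> max D 1"
    by fastforce
  then show ?thesis using that[of "max D 1"] by auto
qed

text \<open>Cells of level m have diameter at most \<open>D / 2 ^ m\<close>, so the vertices are
  dense. This carries bounds on vertex values over to all points.\<close>

lemma corner_approx:
  assumes "x \<in> SG q" "e > 0"
  obtains w where "dist x (Fw q w (q 1)) < e"
proof -
  obtain D where D: "D > 0" "\<And>x y. x \<in> SG q \<Longrightarrow> y \<in> SG q \<Longrightarrow> dist x y \<le> D"
    using SG_bound by blast
  obtain m where m: "D / e < 2 ^ m" using real_arch_pow[of 2 "D / e"] by auto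
  obtain w y where w: "length w = m" "y \<in> SG q" "x = Fw q w y"
    using assms SG_eq_cells[of m] by blast
  have "dist x (Fw q w (q 1)) \<le> D / 2 ^ m"
    using D(2)[of y "q 1"] w by (simp add: Fw_dist divide_right_mono)
  also have "\<dots> < e" using m assms by (simp add: field_simps)
  finally show ?thesis using that by blast
qed

end

section \<open>Energy\<close>

text \<open>The polarized graph energy, built cell by cell with the renormalization 5/3 per level.
  The recursion suits inductions in which the functions are pulled back to a cell;
  \<open>graph_energy_eq\<close> shows that it agrees with the sum over edges.\<close>

primrec edge_form :: "(3 \<Rightarrow> real^2) \<Rightarrow> nat \<Rightarrow> (real^2 \<Rightarrow> real) \<Rightarrow> (real^2 \<Rightarrow> real) \<Rightarrow> real" where
  "edge_form q 0 u v = (1/2) * (\<Sum>i\<in>UNIV. \<Sum>j\<in>UNIV. (u (q i) - u (q j)) * (v (q i) - v (q j)))"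
| "edge_form q (Suc m) u v = (5/3) * (\<Sum>i\<in>UNIV. edge_form q m (\<lambda>x. u (F q i x)) (\<lambda>x. v (F q i x)))"

lemma edge_form_add_left: "edge_form q m (\<lambda>x. u x + v x) w = edge_form q m u w + edge_form q m v w"
  by (induction m arbitrary: u v w) (simp_all add: sum_3 field_simps)

lemma edge_form_scale_left: "edge_form q m (\<lambda>x. c * u x) w = c * edge_form q m u w"
  by (induction m arbitrary: u w) (simp_all add: sum_3 algebra_simps)

lemma edge_form_sym: "edge_form q m u v = edge_form q m v u"
  by (induction m arbitrary: u v) (simp_all add: mult.commute)

lemma edge_form_add_right: "edge_form q m w (\<lambda>x. u x + v x) = edge_form q m w u + edge_form q m w v"
  by (metis edge_form_add_left edge_form_sym)

lemma edge_form_scale_right: "edge_form q m w (\<lambda>x. c * u x) = c * edge_form q m w u"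
  by (metis edge_form_scale_left edge_form_sym)

lemma edge_form_nonneg: "edge_form q m u u \<ge> 0"
  by (induction m arbitrary: u) (simp_all add: sum_nonneg)

lemma edge_form_diff_left: "edge_form q m (\<lambda>x. u x - v x) w = edge_form q m u w - edge_form q m v w"
  using edge_form_add_left[of q m u "\<lambda>x. (-1) * v x" w] edge_form_scale_left[of q m "-1" v w] by simp

lemma edge_form_diff_right: "edge_form q m w (\<lambda>x. u x - v x) = edge_form q m w u - edge_form q m w v"
  by (metis edge_form_diff_left edge_form_sym)

lemmas edge_form_linear = edge_form_add_left edge_form_add_right edge_form_diff_left
  edge_form_diff_right edge_form_scale_left edge_form_scale_right

lemma edge_form_parallelogram:
  "edge_form q m (\<lambda>x. u x + v x) (\<lambda>x. u x + v x) + edge_form q m (\<lambda>x. u x - v x) (\<lambda>x. u x - v x) =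
    2 * edge_form q m u u + 2 * edge_form q m v v"
  by (simp add: edge_form_linear edge_form_sym)

lemma edge_form_add_le:
  "edge_form q m (\<lambda>x. u x + v x) (\<lambda>x. u x + v x) \<le> 2 * edge_form q m u u + 2 * edge_form q m v v"
  using edge_form_parallelogram[of q m u v] edge_form_nonneg[of q m "\<lambda>x. u x - v x"] by linarith

lemma edge_form_polarization:
  "edge_form q m u v =
    (edge_form q m (\<lambda>x. u x + v x) (\<lambda>x. u x + v x) - edge_form q m (\<lambda>x. u x - v x) (\<lambda>x. u x - v x)) / 4"
  by (simp add: edge_form_linear edge_form_sym)

text \<open>The difference of the two sides is the energy of the deviation of \<open>u\<close> from the
  harmonic extension at the three midpoints.\<close>

lemma edge_form_Suc_0: "edge_form q 0 u u \<le> edge_form q (Suc 0) u u"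
proof -
  have "0 \<le> (x - y)\<^sup>2 + (y - z)\<^sup>2 + (x - z)\<^sup>2 + 2 * (x\<^sup>2 + y\<^sup>2 + z\<^sup>2)" for x y z :: real
    by simp
  from this[of "u (F q 1 (q 2)) - (2 * u (q 1) + 2 * u (q 2) + u (q 3)) / 5"
      "u (F q 2 (q 3)) - (2 * u (q 2) + 2 * u (q 3) + u (q 1)) / 5"
      "u (F q 1 (q 3)) - (2 * u (q 1) + 2 * u (q 3) + u (q 2)) / 5"]
  show ?thesis
    using F_corner_commute[of q 2 1] F_corner_commute[of q 3 1] F_corner_commute[of q 3 2]
    by (simp add: sum_3 power2_eq_square field_simps)
qed

lemma edge_form_mono_Suc: "edge_form q m u u \<le> edge_form q (Suc m) u u"
proof (induction m arbitrary: u)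
  case 0
  show ?case by (rule edge_form_Suc_0)
next
  case (Suc m)
  have "(\<Sum>i\<in>UNIV. edge_form q m (\<lambda>x. u (F q i x)) (\<lambda>x. u (F q i x))) \<le>
      (\<Sum>i\<in>UNIV. edge_form q (Suc m) (\<lambda>x. u (F q i x)) (\<lambda>x. u (F q i x)))"
    by (intro sum_mono Suc)
  then show ?case
    by (simp only: edge_form.simps(2)[of q _ u u])
qed

lemma edge_form_mono: "m \<le> n \<Longrightarrow> edge_form q m u u \<le> edge_form q n u u"
  using edge_form_mono_Suc by (rule lift_Suc_mono_le)

section \<open>Edges of the graphs and the limit of the graph energies\<close>

lemma adj_0: "{(x, y). adj q 0 x y} = {(x, y). x \<noteq> y \<and> x \<in> range q \<and> y \<in> range q}"
  by (auto simp: adj_def V0_def)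

lemma adj_Suc: "adj q (Suc m) x y \<longleftrightarrow> (\<exists>i x' y'. x = F q i x' \<and> y = F q i y' \<and> adj q m x' y')"
proof
  assume "adj q (Suc m) x y"
  then obtain w where w: "x \<noteq> y" "length w = Suc m" "x \<in> Fw q w ` V0 q" "y \<in> Fw q w ` V0 q"
    by (auto simp: adj_def)
  then obtain i v where "w = i # v" "length v = m" by (metis length_Suc_conv)
  with w show "\<exists>i x' y'. x = F q i x' \<and> y = F q i y' \<and> adj q m x' y'"
    unfolding adj_def by fastforce
next
  assume "\<exists>i x' y'. x = F q i x' \<and> y = F q i y' \<and> adj q m x' y'"
  then obtain i x' y' w where w: "x = F q i x'" "y = F q i y'" "x' \<noteq> y'" "length w = m"
    "x' \<in> Fw q w ` V0 q" "y' \<in> Fw q w ` V0 q"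
    by (auto simp: adj_def)
  then have "length (i # w) = Suc m" "x \<in> Fw q (i # w) ` V0 q" "y \<in> Fw q (i # w) ` V0 q" "x \<noteq> y"
    by auto
  then show "adj q (Suc m) x y" unfolding adj_def by blast
qed

lemma adj_Suc_eq: "{(x, y). adj q (Suc m) x y} = (\<Union>i. map_prod (F q i) (F q i) ` {(x, y). adj q m x y})"
  by (auto simp: adj_Suc)

lemma finite_adj: "finite {(x, y). adj q m x y}"
proof (induction m)
  case 0
  have "{(x, y). adj q 0 x y} \<subseteq> range q \<times> range q" by (auto simp: adj_0)
  then show ?case by (rule finite_subset) auto
qed (auto simp: adj_Suc_eq)

context gasket
begin

lemma adj_in_SG: "adj q m x y \<Longrightarrow> x \<in> SG q \<and> y \<in> SG q"
  by (auto simp: adj_def V0_def)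

lemma corners_inj: "inj q"
  using dist_corners side_pos by (metis dist_self injI less_irrefl)

lemma sum_adj_0:
  fixes u :: "real^2 \<Rightarrow> real" shows
  "(\<Sum>(x, y)\<in>{(x, y). adj q 0 x y}. (u x - u y)\<^sup>2) = (\<Sum>i\<in>UNIV. \<Sum>j\<in>UNIV. (u (q i) - u (q j))\<^sup>2)"
proof -
  have "(\<Sum>(x, y)\<in>{(x, y). adj q 0 x y}. (u x - u y)\<^sup>2) = (\<Sum>(x, y)\<in>range q \<times> range q. (u x - u y)\<^sup>2)"
    by (rule sum.mono_neutral_left) (auto simp: adj_0 inj_eq[OF corners_inj])
  also have "\<dots> = (\<Sum>x\<in>range q. \<Sum>y\<in>range q. (u x - u y)\<^sup>2)"
    by (simp add: sum.cartesian_product)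
  also have "\<dots> = (\<Sum>i\<in>UNIV. \<Sum>j\<in>UNIV. (u (q i) - u (q j))\<^sup>2)"
    by (simp add: sum.reindex corners_inj)
  finally show ?thesis .
qed

text \<open>Different cells share at most one point, and an edge has two different ends. Hence the
  edges of level m+1 are a disjoint union of three copies of those of level m.\<close>

lemma sum_adj_Suc:
  fixes u :: "real^2 \<Rightarrow> real" shows
  "(\<Sum>(x, y)\<in>{(x, y). adj q (Suc m) x y}. (u x - u y)\<^sup>2) =
    (\<Sum>i\<in>UNIV. \<Sum>(x, y)\<in>{(x, y). adj q m x y}. (u (F q i x) - u (F q i y))\<^sup>2)"
proof -
  have disj: "map_prod (F q i) (F q i) ` {(x, y). adj q m x y} \<inter>
      map_prod (F q j) (F q j) ` {(x, y). adj q m x y} = {}" if "i \<noteq> j" for i j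
  proof (rule ccontr)
    assume "\<not> ?thesis"
    then obtain x y x' y' where *: "F q i x = F q j x'" "F q i y = F q j y'" "adj q m x y" "adj q m x' y'"
      by (auto simp: map_prod_def)
    then have "x = q j" "y = q j"
      using overlap(1)[OF *(1) that] overlap(1)[OF *(2) that] adj_in_SG by blast+
    then show False using *(3) by (auto simp: adj_def)
  qed
  have inj: "inj_on (map_prod (F q i) (F q i)) A" for i A
    by (auto simp: inj_on_def)
  have fin: "finite (map_prod (F q i) (F q i) ` {(x, y). adj q m x y})" for i
    by (intro finite_imageI finite_adj)
  show ?thesis
    unfolding adj_Suc_eq
    by (subst sum.UNION_disjoint) (use disj fin in \<open>auto simp: sum.reindex[OF inj] split_def\<close>)
qed

lemma graph_energy_eq: "graph_energy q m u = edge_form q m u u"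
proof -
  have "(\<Sum>(x, y)\<in>{(x, y). adj q m x y}. (u x - u y)\<^sup>2) = 2 * (3/5) ^ m * edge_form q m u u"
  proof (induction m arbitrary: u)
    case 0
    show ?case unfolding sum_adj_0 by (simp add: power2_eq_square)
  next
    case (Suc m)
    show ?case
      unfolding sum_adj_Suc Suc by (simp add: sum_distrib_left[symmetric])
  qed
  then show ?thesis
    by (simp add: graph_energy_def power_mult_distrib[symmetric] mult.assoc[symmetric])
qed

lemma energy_eq: "energy q u = (SUP m. ennreal (edge_form q m u u))"
proof -
  have "incseq (\<lambda>m. ennreal (edge_form q m u u))"
    by (intro incseq_SucI ennreal_leI edge_form_mono_Suc)
  then show ?thesis
    unfolding energy_def graph_energy_eq by (intro limI LIMSEQ_SUP)
qed

lemma energy_le_iff: "c \<ge> 0 \<Longrightarrow> energy q u \<le> ennreal c \<longleftrightarrow> (\<forall>m. edge_form q m u u \<le> c)"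
  by (auto simp: energy_eq SUP_le_iff)

definition energy_finite :: "(real^2 \<Rightarrow> real) \<Rightarrow> bool" where
  "energy_finite u \<longleftrightarrow> energy q u < \<infinity>"

text \<open>\<open>enn2real\<close> sends infinite energy to 0, so the value is meaningful only
  together with \<open>energy_finite\<close>.\<close>

definition energy_real :: "(real^2 \<Rightarrow> real) \<Rightarrow> real" where
  "energy_real u = enn2real (energy q u)"

lemma energy_finiteI:
  assumes "\<And>m. edge_form q m u u \<le> c"
  shows "energy_finite u" "energy_real u \<le> c"
proof -
  have c: "c \<ge> 0" using assms[of 0] edge_form_nonneg[of q 0 u] by linarith
  then have *: "energy q u \<le> ennreal c" using assms energy_le_iff by blast
  then show "energy_finite u"
    unfolding energy_finite_def using ennreal_less_top le_less_trans by (metis infinity_ennreal_def)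
  show "energy_real u \<le> c"
    unfolding energy_real_def using * c enn2real_leI by blast
qed

lemma edge_form_le_energy: "energy_finite u \<Longrightarrow> edge_form q m u u \<le> energy_real u"
proof -
  assume "energy_finite u"
  then have "energy q u = ennreal (energy_real u)"
    by (simp add: energy_finite_def energy_real_def)
  moreover have "energy_real u \<ge> 0" by (simp add: energy_real_def)
  ultimately show ?thesis
    using energy_le_iff[of "energy_real u" u] by simp
qed

lemma energy_real_nonneg: "energy_real u \<ge> 0"
  by (simp add: energy_real_def)

lemma edge_form_tendsto:
  assumes "energy_finite u"
  shows "(\<lambda>m. edge_form q m u u) \<longlonglongrightarrow> energy_real u"
proof -
  have "bdd_above (range (\<lambda>m. edge_form q m u u))"
    using edge_form_le_energy[OF assms] by (auto simp: bdd_above_def)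
  then have *: "(\<lambda>m. edge_form q m u u) \<longlonglongrightarrow> (SUP m. edge_form q m u u)"
    by (intro LIMSEQ_incseq_SUP incseq_SucI edge_form_mono_Suc)
  have "edge_form q m u u \<le> (SUP m. edge_form q m u u)" for m
    by (intro cSUP_upper) (use \<open>bdd_above _\<close> in auto)
  then have "energy_real u \<le> (SUP m. edge_form q m u u)"
    by (rule energy_finiteI)
  moreover have "(SUP m. edge_form q m u u) \<le> energy_real u"
    by (intro cSUP_least edge_form_le_energy[OF assms]) auto
  ultimately show ?thesis using * by simp
qed

lemma energy_finite_add:
  assumes "energy_finite u" "energy_finite v"
  shows "energy_finite (\<lambda>x. u x + v x)"
proof (rule energy_finiteI)
  fix m
  show "edge_form q m (\<lambda>x. u x + v x) (\<lambda>x. u x + v x) \<le> 2 * energy_real u + 2 * energy_real v"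
    using edge_form_add_le[of q m u v] edge_form_le_energy[OF assms(1), of m]
      edge_form_le_energy[OF assms(2), of m] by linarith
qed

lemma energy_finite_scale:
  assumes "energy_finite u"
  shows "energy_finite (\<lambda>x. c * u x)"
proof (rule energy_finiteI)
  fix m
  show "edge_form q m (\<lambda>x. c * u x) (\<lambda>x. c * u x) \<le> c\<^sup>2 * energy_real u"
    using mult_left_mono[OF edge_form_le_energy[OF assms(1), of m], of "c\<^sup>2"]
    by (simp add: edge_form_linear power2_eq_square mult.assoc)
qed

lemma energy_finite_diff:
  assumes "energy_finite u" "energy_finite v"
  shows "energy_finite (\<lambda>x. u x - v x)"
  using energy_finite_add[OF assms(1) energy_finite_scale[OF assms(2), of "-1"]] by simp

text \<open>The polarization formula does not show that \<open>energy_form\<close> is bilinear. As a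
  limit of the discrete forms, which are polarized by the same formula, it inherits bilinearity from
  them.\<close>

lemma energy_form_tendsto:
  assumes "energy_finite u" "energy_finite v"
  shows "(\<lambda>m. edge_form q m u v) \<longlonglongrightarrow> energy_form q u v"
  unfolding edge_form_polarization[of q _ u v] energy_form_def energy_real_def[symmetric]
  by (intro tendsto_divide tendsto_diff tendsto_const edge_form_tendsto energy_finite_add
      energy_finite_diff assms) simp

lemma energy_form_add_left:
  assumes "energy_finite u" "energy_finite v" "energy_finite w"
  shows "energy_form q (\<lambda>x. u x + v x) w = energy_form q u w + energy_form q v w"
proof (rule LIMSEQ_unique)
  show "(\<lambda>m. edge_form q m (\<lambda>x. u x + v x) w) \<longlonglongrightarrow> energy_form q (\<lambda>x. u x + v x) w"
    by (intro energy_form_tendsto energy_finite_add assms)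
  show "(\<lambda>m. edge_form q m (\<lambda>x. u x + v x) w) \<longlonglongrightarrow> energy_form q u w + energy_form q v w"
    unfolding edge_form_linear by (intro tendsto_add energy_form_tendsto assms)
qed

lemma energy_form_scale_left:
  assumes "energy_finite u" "energy_finite w"
  shows "energy_form q (\<lambda>x. c * u x) w = c * energy_form q u w"
proof (rule LIMSEQ_unique)
  show "(\<lambda>m. edge_form q m (\<lambda>x. c * u x) w) \<longlonglongrightarrow> energy_form q (\<lambda>x. c * u x) w"
    by (intro energy_form_tendsto energy_finite_scale assms)
  show "(\<lambda>m. edge_form q m (\<lambda>x. c * u x) w) \<longlonglongrightarrow> c * energy_form q u w"
    unfolding edge_form_linear by (intro tendsto_intros energy_form_tendsto assms)
qed

lemma energy_form_sym:
  assumes "energy_finite u" "energy_finite v"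
  shows "energy_form q u v = energy_form q v u"
  using LIMSEQ_unique[OF energy_form_tendsto[OF assms]
      energy_form_tendsto[OF assms(2,1), unfolded edge_form_sym[of q _ v u]]] .

lemma energy_form_self: "energy_finite u \<Longrightarrow> energy_form q u u = energy_real u"
  using energy_form_tendsto[of u u] edge_form_tendsto[of u] LIMSEQ_unique by blast

lemma edge_form_cong:
  assumes "\<And>x. x \<in> SG q \<Longrightarrow> u x = u' x" "\<And>x. x \<in> SG q \<Longrightarrow> v x = v' x"
  shows "edge_form q m u v = edge_form q m u' v'"
  using assms
proof (induction m arbitrary: u v u' v')
  case (Suc m)
  have "edge_form q m (\<lambda>x. u (F q i x)) (\<lambda>x. v (F q i x)) =
      edge_form q m (\<lambda>x. u' (F q i x)) (\<lambda>x. v' (F q i x))" for i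
    by (rule Suc.IH) (use Suc.prems in auto)
  then show ?case by simp
qed auto

section \<open>Energy controls oscillation\<close>

lemma sqrt_35_le: "sqrt (3/5) \<le> 4/5"
  by (rule real_le_lsqrt) (auto simp: power2_eq_square)

lemma corner_difference_le: "\<bar>u (q i) - u (q j)\<bar> \<le> sqrt (edge_form q m u u)"
proof -
  have "edge_form q 0 u u =
      (u (q 1) - u (q 2))\<^sup>2 + (u (q 2) - u (q 3))\<^sup>2 + (u (q 1) - u (q 3))\<^sup>2"
    by (simp add: sum_3 power2_eq_square algebra_simps)
  moreover have "0 \<le> (u (q 1) - u (q 2))\<^sup>2" "0 \<le> (u (q 2) - u (q 3))\<^sup>2" "0 \<le> (u (q 1) - u (q 3))\<^sup>2"
    by simp_all
  ultimately have "(u (q i) - u (q j))\<^sup>2 \<le> edge_form q 0 u u"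
    using exhaust_3[of i] exhaust_3[of j] power2_commute[of "u (q i)" "u (q j)"]
    by (elim disjE) (simp_all del: edge_form.simps zero_le_power2)
  also have "\<dots> \<le> edge_form q m u u" by (rule edge_form_mono) simp
  finally show ?thesis by (metis real_sqrt_abs real_sqrt_le_iff)
qed

text \<open>Each level multiplies the energy of the restriction by at most \<open>3/5\<close>, and the
  constant 5 solves \<open>C = 1 + (4/5) C\<close> with \<open>sqrt (3/5) \<le> 4/5\<close>.\<close>

lemma vertex_difference_le:
  "\<bar>u (Fw q w (q k)) - u (q j)\<bar> \<le> 5 * sqrt (edge_form q (length w) u u)"
proof (induction w arbitrary: u j)
  case Nil
  have "\<bar>u (q k) - u (q j)\<bar> \<le> sqrt (edge_form q 0 u u)" by (rule corner_difference_le)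
  moreover have "0 \<le> sqrt (edge_form q 0 u u)" by (simp only: real_sqrt_ge_0_iff edge_form_nonneg)
  ultimately show ?case by simp
next
  case (Cons i w)
  let ?E = "edge_form q (length (i # w)) u u" and ?v = "\<lambda>x. u (F q i x)"
  have "(5/3) * edge_form q (length w) ?v ?v \<le> ?E"
    by (auto intro!: member_le_sum edge_form_nonneg)
  then have "sqrt (edge_form q (length w) ?v ?v) \<le> sqrt (3/5 * ?E)"
    by (intro real_sqrt_le_mono) simp
  also have "\<dots> \<le> 4/5 * sqrt ?E"
    unfolding real_sqrt_mult by (intro mult_right_mono sqrt_35_le real_sqrt_ge_zero edge_form_nonneg)
  finally have "\<bar>?v (Fw q w (q k)) - ?v (q i)\<bar> \<le> 4 * sqrt ?E"
    using Cons.IH[of ?v i] by linarith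
  moreover have "\<bar>u (q i) - u (q j)\<bar> \<le> sqrt ?E"
    by (rule corner_difference_le)
  ultimately show ?case
    using abs_triangle_ineq[of "?v (Fw q w (q k)) - ?v (q i)" "u (q i) - u (q j)"] by simp
qed

text \<open>The bound at the vertices is uniform in the word, so density and continuity extend
  it.\<close>

lemma difference_le:
  assumes "continuous_on (SG q) u" "energy_finite u" "x \<in> SG q"
  shows "\<bar>u x - u (q j)\<bar> \<le> 5 * sqrt (energy_real u)"
proof (rule field_le_epsilon)
  fix e :: real assume "e > 0"
  then obtain d where d: "d > 0" "\<And>y. y \<in> SG q \<Longrightarrow> dist y x < d \<Longrightarrow> dist (u y) (u x) < e"
    using assms(1,3) unfolding continuous_on_iff by metis
  obtain w where "dist x (Fw q w (q 1)) < d" using corner_approx assms(3) d(1) by blast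
  then have "\<bar>u (Fw q w (q 1)) - u x\<bar> < e"
    using d(2)[of "Fw q w (q 1)"] by (simp add: dist_commute dist_real_def)
  moreover have "\<bar>u (Fw q w (q 1)) - u (q j)\<bar> \<le> 5 * sqrt (energy_real u)"
    using vertex_difference_le[of u w 1 j] edge_form_le_energy[OF assms(2), of "length w"]
      real_sqrt_le_mono by (smt (verit))
  ultimately show "\<bar>u x - u (q j)\<bar> \<le> 5 * sqrt (energy_real u) + e" by linarith
qed

text \<open>Discrete product rule: a b - a' b' = (a - a') b + a' (b - b'). It makes the functions of
  finite energy an algebra, so that separating functions can be multiplied.\<close>

lemma edge_form_mult_le:
  assumes "\<And>x. x \<in> SG q \<Longrightarrow> \<bar>u x\<bar> \<le> M" "\<And>x. x \<in> SG q \<Longrightarrow> \<bar>v x\<bar> \<le> M"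
  shows "edge_form q m (\<lambda>x. u x * v x) (\<lambda>x. u x * v x) \<le>
    2 * M\<^sup>2 * (edge_form q m u u + edge_form q m v v)"
  using assms
proof (induction m arbitrary: u v)
  case 0
  have *: "(a * b - a' * b')\<^sup>2 \<le> 2 * M\<^sup>2 * ((a - a')\<^sup>2 + (b - b')\<^sup>2)"
    if "\<bar>a'\<bar> \<le> M" "\<bar>b\<bar> \<le> M" for a b a' b' :: real
  proof -
    have "(a * b - a' * b')\<^sup>2 = ((a - a') * b + a' * (b - b'))\<^sup>2" by (simp add: algebra_simps)
    also have "\<dots> \<le> 2 * ((a - a') * b)\<^sup>2 + 2 * (a' * (b - b'))\<^sup>2"
      using sum_squares_bound[of "(a - a') * b" "a' * (b - b')"] by (simp add: power2_sum)
    also have "\<dots> = 2 * (b\<^sup>2 * (a - a')\<^sup>2) + 2 * (a'\<^sup>2 * (b - b')\<^sup>2)" by (simp add: power_mult_distrib)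
    also have "\<dots> \<le> 2 * (M\<^sup>2 * (a - a')\<^sup>2) + 2 * (M\<^sup>2 * (b - b')\<^sup>2)"
      using that by (intro add_mono mult_left_mono mult_right_mono) (auto simp: abs_le_square_iff[symmetric])
    finally show ?thesis by (simp add: algebra_simps)
  qed
  have "(\<Sum>i\<in>UNIV. \<Sum>j\<in>UNIV. (u (q i) * v (q i) - u (q j) * v (q j))\<^sup>2) \<le>
      (\<Sum>i\<in>UNIV. \<Sum>j\<in>UNIV. 2 * M\<^sup>2 * ((u (q i) - u (q j))\<^sup>2 + (v (q i) - v (q j))\<^sup>2))"
    using 0 by (intro sum_mono *) auto
  also have "\<dots> = 2 * M\<^sup>2 * ((\<Sum>i\<in>UNIV. \<Sum>j\<in>UNIV. (u (q i) - u (q j))\<^sup>2) +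
      (\<Sum>i\<in>UNIV. \<Sum>j\<in>UNIV. (v (q i) - v (q j))\<^sup>2))"
    by (simp add: sum_distrib_left sum.distrib distrib_left)
  finally show ?case by (simp add: power2_eq_square[symmetric] algebra_simps)
next
  case (Suc m)
  have "edge_form q (Suc m) (\<lambda>x. u x * v x) (\<lambda>x. u x * v x) \<le>
     5/3 * (\<Sum>i\<in>UNIV. 2 * M\<^sup>2 * (edge_form q m (\<lambda>x. u (F q i x)) (\<lambda>x. u (F q i x)) +
       edge_form q m (\<lambda>x. v (F q i x)) (\<lambda>x. v (F q i x))))"
    unfolding edge_form.simps
    by (intro mult_left_mono sum_mono Suc.IH Suc.prems F_in_SG) simp_all
  also have "\<dots> = 2 * M\<^sup>2 * (edge_form q (Suc m) u u + edge_form q (Suc m) v v)"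
    unfolding edge_form.simps sum.distrib sum_distrib_left[symmetric] by (simp add: algebra_simps)
  finally show ?case .
qed

lemma energy_finite_mult:
  assumes "continuous_on (SG q) u" "continuous_on (SG q) v" "energy_finite u" "energy_finite v"
  shows "energy_finite (\<lambda>x. u x * v x)"
proof -
  have bdd: "\<exists>M. \<forall>x\<in>SG q. \<bar>u x\<bar> \<le> M" if "continuous_on (SG q) u" for u :: "real^2 \<Rightarrow> real"
    using compact_imp_bounded[OF compact_continuous_image[OF that compact_SG]]
    by (auto simp: bounded_iff)
  obtain M where "\<forall>x\<in>SG q. \<bar>u x\<bar> \<le> M" using bdd assms by blast
  moreover obtain N where "\<forall>x\<in>SG q. \<bar>v x\<bar> \<le> N" using bdd assms by blast
  ultimately have M: "x \<in> SG q \<Longrightarrow> \<bar>u x\<bar> \<le> max M N" "x \<in> SG q \<Longrightarrow> \<bar>v x\<bar> \<le> max M N" for x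
    by force+
  show ?thesis
  proof (rule energy_finiteI)
    fix m
    have "edge_form q m (\<lambda>x. u x * v x) (\<lambda>x. u x * v x) \<le>
        2 * (max M N)\<^sup>2 * (edge_form q m u u + edge_form q m v v)"
      by (rule edge_form_mult_le) (use M in auto)
    also have "\<dots> \<le> 2 * (max M N)\<^sup>2 * (energy_real u + energy_real v)"
      using assms by (intro mult_left_mono add_mono edge_form_le_energy) auto
    finally show "edge_form q m (\<lambda>x. u x * v x) (\<lambda>x. u x * v x) \<le>
        2 * (max M N)\<^sup>2 * (energy_real u + energy_real v)" .
  qed
qed

lemma domE_iff:
  "u \<in> domE q \<longleftrightarrow> continuous_on (SG q) u \<and> (\<forall>x. x \<notin> SG q \<longrightarrow> u x = 0) \<and> energy_finite u"
  by (simp add: domE_def energy_finite_def)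

lemma domE0_iff: "u \<in> domE0 q \<longleftrightarrow> u \<in> domE q \<and> (\<forall>i. u (q i) = 0)"
  by (auto simp: domE0_def V0_def)

end

section \<open>The self-similar measure\<close>

context gasket
begin

lemma closed_cell: "closed (Fw q w ` SG q)"
  by (intro compact_imp_closed compact_continuous_image continuous_on_Fw compact_SG)

lemma closed_SG: "closed (SG q)"
  by (intro compact_imp_closed compact_SG)

lemma finite_words: "finite {w :: 3 list. length w = m}"
  using finite_lists_length_eq[of "UNIV :: 3 set" m] by simp

lemma card_words: "card {w :: 3 list. length w = m} = 3 ^ m"
  using card_lists_length_eq[of "UNIV :: 3 set" m] by simp

definition self_similar_measure :: "(real^2) measure \<Rightarrow> bool" where
  "self_similar_measure M \<longleftrightarrow> sets M = sets borel \<and> prob_space M \<and>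
     (\<forall>w. measure M (Fw q w ` SG q) = (1/3) ^ length w)"

lemma self_similar_measure_SG: "self_similar_measure M \<Longrightarrow> measure M (SG q) = 1"
  using spec[of "\<lambda>w. measure M (Fw q w ` SG q) = (1/3) ^ length w" "[]"]
  by (simp add: self_similar_measure_def)

text \<open>The cells in \<open>W\<close> and the remaining ones have total measure at most their number
  over \<open>3 ^ m\<close>, and together they have full measure, so both bounds are attained.\<close>

lemma measure_cells:
  assumes "self_similar_measure M" and W: "W \<subseteq> {w. length w = m}"
  shows "measure M (\<Union>w\<in>W. Fw q w ` SG q) = card W * (1/3) ^ m"
proof -
  interpret prob_space M using assms by (simp add: self_similar_measure_def)
  have sets: "Fw q w ` SG q \<in> sets M" for w
    using assms closed_cell by (simp add: self_similar_measure_def)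
  have le: "measure M (\<Union>w\<in>W. Fw q w ` SG q) \<le> card W * (1/3) ^ m" if W: "W \<subseteq> {w. length w = m}" for W
  proof -
    have "measure M (\<Union>w\<in>W. Fw q w ` SG q) \<le> (\<Sum>w\<in>W. measure M (Fw q w ` SG q))"
      using finite_subset[OF W finite_words] sets by (intro finite_measure_subadditive_finite) auto
    also have "\<dots> = (\<Sum>w\<in>W. (1/3) ^ m)"
      using W assms by (intro sum.cong) (auto simp: self_similar_measure_def)
    finally show ?thesis by simp
  qed
  let ?W' = "{w. length w = m} - W"
  have "SG q = (\<Union>w\<in>W. Fw q w ` SG q) \<union> (\<Union>w\<in>?W'. Fw q w ` SG q)"
    using W by (subst SG_eq_cells[of m]) blast
  moreover have "measure M (SG q) = 1"
    using assms self_similar_measure_SG by blast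
  ultimately have "1 \<le> measure M (\<Union>w\<in>W. Fw q w ` SG q) + measure M (\<Union>w\<in>?W'. Fw q w ` SG q)"
    using measure_Un_le[of "\<Union>w\<in>W. Fw q w ` SG q" M "\<Union>w\<in>?W'. Fw q w ` SG q"]
      finite_subset[OF W finite_words] finite_words[of m] sets
    by (simp add: sets.finite_UN)
  moreover have "measure M (\<Union>w\<in>?W'. Fw q w ` SG q) \<le> card ?W' * (1/3) ^ m"
    by (rule le) auto
  moreover have "real (card ?W') * (1/3) ^ m = 1 - card W * (1/3) ^ m"
  proof -
    have "card ?W' = 3 ^ m - card W"
      using W finite_words[of m] by (simp add: card_Diff_subset finite_subset card_words)
    moreover have "card W \<le> 3 ^ m"
      using card_mono[OF finite_words W] by (simp add: card_words)
    ultimately show ?thesis by (simp add: of_nat_diff field_simps)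
  qed
  ultimately show ?thesis using le[OF W] by linarith
qed

section \<open>Uniqueness of the measure\<close>

lemma Fw_image_append_subset: "Fw q (v @ w) ` SG q \<subseteq> Fw q v ` SG q"
  by (auto simp: Fw_append)

text \<open>A point of the right side has points of \<open>A\<close> in its cell at every level, and
  the cells shrink, so it lies in the closure of \<open>A\<close>. Closed sets thus become
  decreasing limits of finite unions of cells, whose masses are prescribed.\<close>

lemma closed_Int_SG_eq:
  assumes "closed A"
  shows "A \<inter> SG q = (\<Inter>m. \<Union>w\<in>{w. length w = m \<and> Fw q w ` SG q \<inter> A \<noteq> {}}. Fw q w ` SG q)"
    (is "_ = (\<Inter>m. ?U m)")
proof
  show "A \<inter> SG q \<subseteq> (\<Inter>m. ?U m)"
  proof safe
    fix x m assume "x \<in> A" "x \<in> SG q"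
    moreover from this obtain w where "length w = m" "x \<in> Fw q w ` SG q"
      using SG_eq_cells[of m] by blast
    ultimately show "x \<in> ?U m" by blast
  qed
  show "(\<Inter>m. ?U m) \<subseteq> A \<inter> SG q"
  proof
    fix x assume x: "x \<in> (\<Inter>m. ?U m)"
    obtain D where D: "D > 0" "\<And>x y. x \<in> SG q \<Longrightarrow> y \<in> SG q \<Longrightarrow> dist x y \<le> D"
      using SG_bound by blast
    have "\<exists>y\<in>A. dist y x < e" if "e > 0" for e
    proof -
      obtain m where m: "D / e < 2 ^ m" using real_arch_pow[of 2 "D / e"] by auto
      obtain w y z where w: "length w = m" "y \<in> SG q" "z \<in> SG q" "x = Fw q w y" "Fw q w z \<in> A"
      proof -
        have "x \<in> ?U m" using x by blast
        then show ?thesis using that by blast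
      qed
      have "dist (Fw q w z) x \<le> D / 2 ^ m"
        using D(2)[of z y] w by (simp add: Fw_dist divide_right_mono)
      also have "\<dots> < e" using m that by (simp add: field_simps)
      finally show ?thesis using w(5) by blast
    qed
    then have "x \<in> closure A" by (simp add: closure_approachable)
    moreover have "x \<in> ?U 0" using x by blast
    then have "x \<in> SG q" by (auto split: if_splits)
    ultimately show "x \<in> A \<inter> SG q" using assms by simp
  qed
qed

lemma measure_Int_SG:
  assumes "sets M = sets borel" "prob_space M" "measure M (SG q) = 1" "A \<in> sets borel"
  shows "measure M A = measure M (A \<inter> SG q)"
proof -
  interpret prob_space M by fact
  have "space M = UNIV" using sets_eq_imp_space_eq[OF assms(1)] by simp
  then have "measure M (A - SG q) \<le> measure M (space M - SG q)"
    using assms closed_SG by (intro finite_measure_mono) auto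
  also have "\<dots> = 0"
    using prob_compl[of "SG q"] assms closed_SG by simp
  finally have "measure M (A - SG q) = 0" using measure_nonneg[of M "A - SG q"] by linarith
  then show ?thesis
    using finite_measure_Diff'[of A "SG q"] assms closed_SG by simp
qed

text \<open>On a closed set both measures are the limit of the same numbers, the count of level m
  cells meeting the set divided by 3^m. Closed sets are stable under intersection and generate the
  Borel sets.\<close>

lemma self_similar_measure_unique:
  assumes M: "self_similar_measure M" and N: "self_similar_measure N"
  shows "M = N"
proof -
  have eq: "measure M A = measure N A" if "closed A" for A
  proof -
    define W where "W m = {w. length w = m \<and> Fw q w ` SG q \<inter> A \<noteq> {}}" for m
    define U where "U m = (\<Union>w\<in>W m. Fw q w ` SG q)" for m
    have lim: "(\<lambda>m. card (W m) * (1/3) ^ m) \<longlonglongrightarrow> measure L A" if L: "self_similar_measure L" for L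
    proof -
      interpret prob_space L using L by (simp add: self_similar_measure_def)
      have sL: "sets L = sets borel" using L by (simp add: self_similar_measure_def)
      have "finite (W m)" for m
        unfolding W_def by (rule finite_subset[OF _ finite_words[of m]]) auto
      then have U: "U m \<in> sets L" for m
        unfolding U_def sL using closed_cell by (intro sets.finite_UN) auto
      have "U (Suc m) \<subseteq> U m" for m
      proof
        fix x assume "x \<in> U (Suc m)"
        then obtain w where w: "w \<in> W (Suc m)" "x \<in> Fw q w ` SG q" by (auto simp: U_def)
        then have "Fw q w ` SG q \<subseteq> Fw q (take m w) ` SG q"
          using Fw_image_append_subset[of "take m w" "drop m w"] by simp
        then have "take m w \<in> W m" "x \<in> Fw q (take m w) ` SG q"
          using w by (auto simp: W_def)
        then show "x \<in> U m" by (auto simp: U_def)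
      qed
      then have "decseq U" by (rule decseq_SucI)
      then have "(\<lambda>m. measure L (U m)) \<longlonglongrightarrow> measure L (\<Inter>m. U m)"
        using U by (intro finite_Lim_measure_decseq) auto
      moreover have "(\<Inter>m. U m) = A \<inter> SG q"
        using closed_Int_SG_eq[OF \<open>closed A\<close>] by (simp add: U_def W_def)
      moreover have "measure L A = measure L (A \<inter> SG q)"
        using measure_Int_SG[OF sL prob_space_axioms self_similar_measure_SG[OF L], of A] \<open>closed A\<close>
        by simp
      moreover have "measure L (U m) = card (W m) * (1/3) ^ m" for m
        unfolding U_def by (rule measure_cells[OF L]) (auto simp: W_def)
      ultimately show ?thesis by simp
    qed
    show ?thesis using LIMSEQ_unique[OF lim[OF M] lim[OF N]] .
  qed
  interpret M: prob_space M using M by (simp add: self_similar_measure_def)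
  interpret N: prob_space N using N by (simp add: self_similar_measure_def)
  have sets: "sets M = sigma_sets UNIV (Collect closed)" "sets N = sigma_sets UNIV (Collect closed)"
    using M N by (simp_all add: self_similar_measure_def borel_eq_closed)
  show ?thesis
  proof (rule measure_eqI_generator_eq[where A = "\<lambda>_. UNIV", OF _ _ _ sets])
    show "Int_stable (Collect closed :: (real^2) set set)" by (auto simp: Int_stable_def)
    show "emeasure M A = emeasure N A" if "A \<in> Collect closed" for A
      using eq[of A] that by (simp add: M.emeasure_eq_measure N.emeasure_eq_measure)
  qed auto
qed

section \<open>Existence of the measure: the law of a point with random address\<close>

lemma self_similar_measureI:
  assumes M: "sets M = sets borel" "prob_space M" "measure M (SG q) = 1"
    and sim: "\<And>B. B \<in> sets borel \<Longrightarrow> measure M B = (\<Sum>i\<in>UNIV. measure M (F q i -` B)) / 3"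
  shows "self_similar_measure M"
proof -
  interpret prob_space M by fact
  have spM: "space M = UNIV" using sets_eq_imp_space_eq[OF M(1)] by simp
  have F_meas: "F q i -` B \<in> sets borel" if "B \<in> sets borel" for i B
    using measurable_sets[OF borel_measurable_continuous_onI[OF continuous_on_F] that] by simp
  have null: "measure M (F q i -` B) = 0"
    if "B \<in> sets borel" "F q i -` B \<inter> SG q \<subseteq> N" "measure M N = 0" "N \<in> sets borel" for B N i
  proof -
    have "measure M (F q i -` B) = measure M (F q i -` B \<inter> SG q)"
      by (rule measure_Int_SG[OF M F_meas[OF that(1)]])
    also have "\<dots> \<le> measure M N"
      using that M by (intro finite_measure_mono) auto
    finally show ?thesis using that measure_nonneg[of M "F q i -` B"] by linarith
  qed
  \<comment> \<open>Within the gasket only \<open>F q j\<close> reaches \<open>q j\<close>, and only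
    from \<open>q j\<close> itself, so self-similarity makes this mass a third of itself.\<close>
  have corner: "measure M {q j} = 0" for j
  proof -
    have "measure M (F q i -` {q j}) = (if i = j then measure M {q j} else 0)" for i
    proof (cases "i = j")
      case True
      then have "F q i -` {q j} = {q j}" using F_eq_iff[of q j _ "q j"] by auto
      then show ?thesis using True by simp
    next
      case False
      then have "F q i -` {q j} \<inter> SG q \<subseteq> {}" using F_eq_corner by blast
      then show ?thesis using null[of "{q j}" i "{}"] False by simp
    qed
    then have "measure M {q j} = measure M {q j} / 3"
      using sim[of "{q j}"] by simp
    then show ?thesis by simp
  qed
  have cell: "measure M (F q i ` A) = measure M A / 3" if A: "compact A" "A \<subseteq> SG q" for i A
  proof -
    have cl: "closed (F q i ` A)"
      by (intro compact_imp_closed compact_continuous_image continuous_on_F A)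
    have "measure M (F q j -` F q i ` A) = (if j = i then measure M A else 0)" for j
    proof (cases "j = i")
      case True
      have "F q i -` F q i ` A = A" by auto
      then show ?thesis using True by simp
    next
      case False
      have "F q j -` F q i ` A \<inter> SG q \<subseteq> {q i}"
        using overlap(1)[OF _ False] A(2) by fastforce
      then show ?thesis using null[of "F q i ` A" j "{q i}"] corner False cl by simp
    qed
    then show ?thesis using sim[of "F q i ` A"] cl by simp
  qed
  have "measure M (Fw q w ` SG q) = (1/3) ^ length w" for w
  proof (induction w)
    case (Cons i w)
    have "measure M (F q i ` (Fw q w ` SG q)) = measure M (Fw q w ` SG q) / 3"
      by (intro cell compact_continuous_image continuous_on_Fw compact_SG) auto
    then show ?case using Cons by (simp add: image_comp)
  qed (use M in simp)
  then show ?thesis using M by (simp add: self_similar_measure_def)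
qed

text \<open>The point with address \<omega>: unrolling \<open>F q i x = (x + q i) / 2\<close> along
  the letters turns the limit of the composed maps into this series.\<close>

definition code_point :: "(nat \<Rightarrow> 3) \<Rightarrow> real^2" where
  "code_point \<omega> = (\<Sum>n. (1/2) ^ Suc n *\<^sub>R q (\<omega> n))"

lemma summable_code: "summable (\<lambda>n. (1/2) ^ Suc n *\<^sub>R q (\<omega> n))"
  and norm_code_point_le: "norm (code_point \<omega>) \<le> (\<Sum>i\<in>UNIV. norm (q i))"
proof -
  let ?B = "\<Sum>i\<in>UNIV. norm (q i)"
  have le: "norm ((1/2) ^ Suc n *\<^sub>R q (\<omega> n)) \<le> (1/2) ^ Suc n * ?B" for n
    using member_le_sum[of "\<omega> n" UNIV "\<lambda>i. norm (q i)"] by simp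
  have sums: "(\<lambda>n. (1/2) ^ Suc n * ?B) sums (1 * ?B)"
    by (intro sums_mult2 power_half_series)
  show "summable (\<lambda>n. (1/2) ^ Suc n *\<^sub>R q (\<omega> n))"
    using le by (intro summable_comparison_test[OF _ sums_summable[OF sums]]) auto
  show "norm (code_point \<omega>) \<le> ?B"
    unfolding code_point_def using norm_suminf_le[OF le sums_summable[OF sums]] sums_unique[OF sums]
    by simp
qed

lemma code_point_case_nat: "code_point (case_nat i \<omega>) = F q i (code_point \<omega>)"
proof -
  let ?f = "\<lambda>n. (1/2) ^ Suc n *\<^sub>R q (case_nat i \<omega> n)"
  have "code_point (case_nat i \<omega>) = (\<Sum>n. ?f (Suc n)) + ?f 0"
    unfolding code_point_def by (simp only: suminf_split_head[OF summable_code] diff_add_cancel)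
  also have "(\<Sum>n. ?f (Suc n)) = (\<Sum>n. (1/2) *\<^sub>R ((1/2) ^ Suc n *\<^sub>R q (\<omega> n)))"
    by simp
  also have "\<dots> = (1/2) *\<^sub>R code_point \<omega>"
    unfolding code_point_def by (intro suminf_scaleR_right[symmetric] summable_code)
  finally show ?thesis by (simp add: F_def scaleR_add_right)
qed

text \<open>Dropping the first letter undoes one contraction, so the distance to the gasket is half
  that of the shifted address. A bound \<open>C\<close> valid for all addresses can then be halved
  indefinitely.\<close>

lemma code_point_in_SG: "code_point \<omega> \<in> SG q"
proof -
  define C where "C = (\<Sum>i\<in>UNIV. norm (q i)) + norm (q 1)"
  have le: "infdist (code_point \<omega>) (SG q) \<le> C / 2 ^ n" for n \<omega>
  proof (induction n arbitrary: \<omega>)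
    case 0
    have "infdist (code_point \<omega>) (SG q) \<le> dist (code_point \<omega>) (q 1)" by (rule infdist_le) simp
    also have "\<dots> \<le> C"
      using norm_triangle_ineq4[of "code_point \<omega>" "q 1"] norm_code_point_le[of \<omega>]
      by (simp add: dist_norm C_def)
    finally show ?case by simp
  next
    case (Suc n)
    let ?x = "code_point (\<lambda>k. \<omega> (Suc k))"
    obtain y where y: "y \<in> SG q" "infdist ?x (SG q) = dist ?x y"
      using infdist_attains_inf[OF closed_SG, of ?x] corner_in_SG by blast
    have "\<omega> = case_nat (\<omega> 0) (\<lambda>k. \<omega> (Suc k))" by (auto split: nat.split)
    then have "code_point \<omega> = F q (\<omega> 0) ?x" using code_point_case_nat by metis
    moreover have "infdist (F q (\<omega> 0) ?x) (SG q) \<le> dist (F q (\<omega> 0) ?x) (F q (\<omega> 0) y)"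
      by (rule infdist_le) (simp add: y)
    ultimately show ?case using Suc[of "\<lambda>k. \<omega> (Suc k)"] y by (simp add: F_dist)
  qed
  have "(\<lambda>n. C / 2 ^ n) \<longlonglongrightarrow> 0" by (rule LIMSEQ_divide_realpow_zero) simp
  then have "infdist (code_point \<omega>) (SG q) \<le> 0"
    using le by (intro LIMSEQ_le_const) auto
  then have "infdist (code_point \<omega>) (SG q) = 0" using infdist_nonneg[of "code_point \<omega>" "SG q"] by linarith
  then show ?thesis
    using in_closed_iff_infdist_zero[OF closed_SG] corner_in_SG by blast
qed

text \<open>The letters are independent and uniform. Conditioning on the first one yields the
  identity required by \<open>self_similar_measureI\<close>, because prepending a letter to the
  address applies the corresponding map.\<close>

lemma self_similar_measure_exists: "\<exists>M. self_similar_measure M"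
proof -
  define p where "p = measure_pmf (pmf_of_set (UNIV :: 3 set))"
  define S where "S = PiM (UNIV :: nat set) (\<lambda>_. p)"
  have "prob_space p" unfolding p_def by (rule measure_pmf.prob_space_axioms)
  interpret P: sequence_space p
    by (simp add: \<open>prob_space p\<close> sequence_space_def product_prob_space_def product_sigma_finite_def
        product_prob_space_axioms_def prob_space_imp_sigma_finite)
  have SP: "S = P.S" by (simp add: S_def)
  interpret S: prob_space S unfolding SP by (rule P.prob_space_axioms)
  have [measurable]: "(\<lambda>\<omega>. \<omega> n) \<in> S \<rightarrow>\<^sub>M p" for n
    unfolding S_def by measurable
  have [measurable]: "q \<in> borel_measurable p" by (simp add: p_def)
  have code [measurable]: "code_point \<in> borel_measurable S"
  proof (rule borel_measurable_LIMSEQ_metric)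
    show "(\<lambda>\<omega>. \<Sum>n<m. (1/2) ^ Suc n *\<^sub>R q (\<omega> n)) \<in> borel_measurable S" for m
      by measurable
    show "(\<lambda>m. \<Sum>n<m. (1/2) ^ Suc n *\<^sub>R q (\<omega> n)) \<longlonglongrightarrow> code_point \<omega>" for \<omega>
      unfolding code_point_def by (rule summable_LIMSEQ[OF summable_code])
  qed
  have F_meas [measurable]: "F q i \<in> borel_measurable borel" for i
    by (intro borel_measurable_continuous_onI continuous_on_F)
  define M where "M = distr S borel code_point"
  interpret M: prob_space M unfolding M_def by (rule S.prob_space_distr) simp
  have spS: "space S = UNIV" by (simp add: S_def space_PiM p_def)
  have M_eq: "measure M B = measure S {\<omega>. code_point \<omega> \<in> B}" if "B \<in> sets borel" for B
    unfolding M_def using that by (simp add: measure_distr spS vimage_def)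
  have "self_similar_measure M"
  proof (rule self_similar_measureI)
    show "sets M = sets borel" "prob_space M" by (simp_all add: M_def M.prob_space_axioms[unfolded M_def])
    have "{\<omega>. code_point \<omega> \<in> SG q} = space S" using code_point_in_SG spS by auto
    then show "measure M (SG q) = 1" using M_eq[of "SG q"] closed_SG S.prob_space by simp
    fix B :: "(real^2) set" assume B [measurable]: "B \<in> sets borel"
    define A where "A = {\<omega>. code_point \<omega> \<in> B}"
    have A: "A = {\<omega> \<in> space S. code_point \<omega> \<in> B}" by (simp add: A_def spS)
    have AS: "A \<in> sets S" unfolding A by measurable
    have g: "(\<lambda>(s, \<omega>). case_nat s \<omega>) \<in> p \<Otimes>\<^sub>M S \<rightarrow>\<^sub>M S"
      unfolding S_def by measurable
    have FB: "F q i -` B \<in> sets borel" for i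
      using measurable_sets[OF F_meas B] by simp
    \<comment> \<open>A random sequence has the law of a random first letter followed by an
      independent random sequence.\<close>
    have "emeasure S A = emeasure (distr (p \<Otimes>\<^sub>M S) S (\<lambda>(s, \<omega>). case_nat s \<omega>)) A"
      using P.PiM_iter by (simp add: SP)
    also have "\<dots> = emeasure (p \<Otimes>\<^sub>M S) ((\<lambda>(s, \<omega>). case_nat s \<omega>) -` A \<inter> space (p \<Otimes>\<^sub>M S))"
      by (rule emeasure_distr[OF g AS])
    also have "\<dots> = (\<integral>\<^sup>+s. emeasure S (Pair s -` ((\<lambda>(s, \<omega>). case_nat s \<omega>) -` A \<inter> space (p \<Otimes>\<^sub>M S))) \<partial>p)"
      by (rule S.emeasure_pair_measure_alt) (rule measurable_sets[OF g AS])
    also have "\<dots> = (\<integral>\<^sup>+s. ennreal (measure M (F q s -` B)) \<partial>p)"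
    proof (rule nn_integral_cong)
      fix s
      have "Pair s -` ((\<lambda>(s, \<omega>). case_nat s \<omega>) -` A \<inter> space (p \<Otimes>\<^sub>M S)) = {\<omega>. code_point \<omega> \<in> F q s -` B}"
        by (auto simp: A_def code_point_case_nat space_pair_measure spS p_def)
      then show "emeasure S (Pair s -` ((\<lambda>(s, \<omega>). case_nat s \<omega>) -` A \<inter> space (p \<Otimes>\<^sub>M S))) =
          ennreal (measure M (F q s -` B))"
        using M_eq[OF FB[of s]] by (simp add: S.emeasure_eq_measure)
    qed
    also have "\<dots> = (\<Sum>s\<in>UNIV. ennreal (measure M (F q s -` B))) / 3"
      unfolding p_def by (subst nn_integral_pmf_of_set) auto
    also have "\<dots> = ennreal ((\<Sum>s\<in>UNIV. measure M (F q s -` B)) / 3)"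
      by (simp add: sum_nonneg divide_ennreal[symmetric])
    finally show "measure M B = (\<Sum>i\<in>UNIV. measure M (F q i -` B)) / 3"
      using M_eq[OF B] by (simp add: A_def S.emeasure_eq_measure sum_nonneg)
  qed
  then show ?thesis by blast
qed

lemma SG_measure: "self_similar_measure (SG_measure q)"
proof -
  have "\<exists>!M. self_similar_measure M"
    using self_similar_measure_exists self_similar_measure_unique by blast
  then show ?thesis
    unfolding SG_measure_def self_similar_measure_def[abs_def] by (rule theI')
qed

lemma sets_SG_measure [simp]: "sets (SG_measure q) = sets borel"
  and prob_space_SG_measure: "prob_space (SG_measure q)"
  using SG_measure by (auto simp: self_similar_measure_def)

end

section \<open>Harmonic functions\<close>

text \<open>The values at the corners of the cell \<open>i\<close> of the harmonic function with corner values \<open>a\<close>: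
  this is the rule \<open>(2 a\<^sub>i + 2 a\<^sub>j + a\<^sub>k) / 5\<close> for the midpoint of \<open>q\<^sub>i\<close> and \<open>q\<^sub>j\<close>.\<close>

definition harmonic_restrict :: "3 \<Rightarrow> (3 \<Rightarrow> real) \<Rightarrow> 3 \<Rightarrow> real" where
  "harmonic_restrict i a j = (if i = j then a i else (sum a UNIV + a i + a j) / 5)"

text \<open>Consistency: the midpoint of \<open>q i\<close> and \<open>q j\<close> gets the same
  value from either cell.\<close>

lemma harmonic_restrict_commute: "harmonic_restrict i a j = harmonic_restrict j a i"
  by (simp add: harmonic_restrict_def)

lemma harmonic_restrict_same [simp]: "harmonic_restrict i a i = a i"
  by (simp add: harmonic_restrict_def)

lemma harmonic_restrict_uminus: "harmonic_restrict i (\<lambda>j. - a j) = (\<lambda>j. - harmonic_restrict i a j)"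
  by (auto simp: harmonic_restrict_def sum_negf field_simps)

lemma harmonic_restrict_ge:
  assumes "\<And>j. c \<le> a j"
  shows "c \<le> harmonic_restrict i a j"
  using assms[of 1] assms[of 2] assms[of 3] assms[of i] assms[of j]
  by (simp add: harmonic_restrict_def sum_3)

text \<open>The worst case is a corner against a midpoint, where the difference is (2 (a_i - a_j) +
  (a_i - a_k)) / 5. Two midpoints differ only by a fifth of a corner difference.\<close>

lemma harmonic_restrict_oscillation:
  assumes "\<And>j k. \<bar>a j - a k\<bar> \<le> s"
  shows "\<bar>harmonic_restrict i a j - harmonic_restrict i a k\<bar> \<le> 3/5 * s"
  using assms[of 1 2] assms[of 1 3] assms[of 2 3] exhaust_3[of i] exhaust_3[of j] exhaust_3[of k]
  by (auto simp: harmonic_restrict_def sum_3 abs_le_iff field_simps)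

text \<open>Every harmonic function on a cell extends to the whole gasket; this is what lets the
  separation of points descend into a common cell.\<close>

lemma harmonic_restrict_surj: "\<exists>a. harmonic_restrict i a = b"
proof
  \<comment> \<open>Let S be the sum of the unknown values. Summing the rule over the cell gives
    \<open>sum b UNIV\<close> = (3 S + 6 b_i) / 5; solving for S and inserting it in b_j = (S + b_i
    + a_j) / 5 gives the witness.\<close>
  show "harmonic_restrict i (\<lambda>j. if j = i then b i else 5 * b j + b i - 5 * sum b UNIV / 3) = b"
    using exhaust_3[of i] by (auto simp: fun_eq_iff forall_3 harmonic_restrict_def sum_3 field_simps)
qed

text \<open>Harmonic extension is the case of equality in \<open>edge_form_Suc_0\<close>: no
  deviation, hence no gain of energy.\<close>

lemma harmonic_restrict_energy:
  "5/3 * (\<Sum>i\<in>UNIV. \<Sum>j\<in>UNIV. \<Sum>k\<in>UNIV. (harmonic_restrict i a j - harmonic_restrict i a k)\<^sup>2) =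
    (\<Sum>j\<in>UNIV. \<Sum>k\<in>UNIV. (a j - a k)\<^sup>2)"
  by (simp add: sum_3 harmonic_restrict_def power2_eq_square field_simps)

section \<open>Construction of the harmonic functions\<close>

context gasket
begin

text \<open>Descends m levels towards \<open>x\<close>, updating the corner values, and interpolates
  affinely in the cell reached; \<open>2 *\<^sub>R x - q i\<close> inverts \<open>F q i\<close>.
  Affine interpolation at the end makes each approximation a continuous function on the whole
  gasket.\<close>

primrec harmonic_approx :: "nat \<Rightarrow> (3 \<Rightarrow> real) \<Rightarrow> real^2 \<Rightarrow> real" where
  "harmonic_approx 0 a x = (\<Sum>j\<in>UNIV. a j * bary j x)"
| "harmonic_approx (Suc m) a x =
    (let i = SOME i. x \<in> F q i ` SG q in harmonic_approx m (harmonic_restrict i a) (2 *\<^sub>R x - q i))"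

lemma F_inverse_left: "2 *\<^sub>R F q i x - q i = x"
  by (simp add: F_def)

lemma harmonic_approx_corner: "harmonic_approx m a (q j) = a j"
proof (induction m arbitrary: a)
  case (Suc m)
  have "(SOME i. q j \<in> F q i ` SG q) = j"
  proof (rule some_equality)
    show "q j \<in> F q j ` SG q" by (rule image_eqI[of _ _ "q j"]) simp_all
    show "\<And>i. q j \<in> F q i ` SG q \<Longrightarrow> i = j" using F_eq_corner(1) by (metis imageE)
  qed
  moreover have "2 *\<^sub>R q j - q j = q j" by (simp add: scaleR_2)
  ultimately show ?case using Suc by simp
qed (simp add: bary_corner if_distrib cong: if_cong)

text \<open>A junction point lies in two cells, between which \<open>SOME\<close> chooses in the definition of
  \<^const>\<open>harmonic_approx\<close>; the value does not depend on this choice.\<close>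

lemma harmonic_approx_F:
  assumes "x \<in> SG q"
  shows "harmonic_approx (Suc m) a (F q i x) = harmonic_approx m (harmonic_restrict i a) x"
proof -
  define j where "j = (SOME j. F q i x \<in> F q j ` SG q)"
  have "\<exists>j. F q i x \<in> F q j ` SG q" using assms by blast
  then have "F q i x \<in> F q j ` SG q" unfolding j_def by (rule someI_ex)
  then obtain y where y: "y \<in> SG q" "F q i x = F q j y" by blast
  have "harmonic_approx (Suc m) a (F q i x) = harmonic_approx m (harmonic_restrict j a) y"
    unfolding harmonic_approx.simps Let_def j_def[symmetric] by (simp add: y(2) F_inverse_left)
  also have "\<dots> = harmonic_approx m (harmonic_restrict i a) x"
  proof (cases "i = j")
    case False
    then have "x = q j" "y = q i" using overlap[OF y(2) False assms y(1)] by auto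
    then show ?thesis by (simp add: harmonic_approx_corner harmonic_restrict_commute)
  qed (use y in simp)
  finally show ?thesis .
qed

lemma harmonic_approx_uminus: "harmonic_approx m (\<lambda>j. - a j) x = - harmonic_approx m a x"
  by (induction m arbitrary: a x) (simp_all add: sum_negf harmonic_restrict_uminus Let_def)

lemma harmonic_approx_ge:
  assumes "\<And>j. c \<le> a j" "x \<in> SG q"
  shows "c \<le> harmonic_approx m a x"
  using assms
proof (induction m arbitrary: a x)
  case 0
  have x: "x \<in> tri" using 0 SG_subset_tri by blast
  then have "c = (\<Sum>j\<in>UNIV. c * bary j x)" by (simp add: tri_def sum_distrib_left[symmetric])
  also have "\<dots> \<le> harmonic_approx 0 a x"
    using x 0 by (auto simp: tri_def intro!: sum_mono mult_right_mono)
  finally show ?case .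
next
  case (Suc m)
  obtain i y where "x = F q i y" "y \<in> SG q" using Suc.prems SG_cases by blast
  then show ?case
    using Suc.IH[of "harmonic_restrict i a" y] harmonic_restrict_ge[of c a] Suc.prems
    by (simp only: harmonic_approx_F)
qed

lemma harmonic_approx_le: "(\<And>j. a j \<le> c) \<Longrightarrow> x \<in> SG q \<Longrightarrow> harmonic_approx m a x \<le> c"
  using harmonic_approx_ge[of "- c" "\<lambda>j. - a j" x m] by (simp add: harmonic_approx_uminus)

lemma harmonic_approx_step:
  assumes "\<And>j k. \<bar>a j - a k\<bar> \<le> s" "x \<in> SG q"
  shows "\<bar>harmonic_approx (Suc m) a x - harmonic_approx m a x\<bar> \<le> (3/5) ^ m * (2 * s)"
  using assms
proof (induction m arbitrary: a x s)
  case 0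
  \<comment> \<open>Both approximations lie in this interval around the first corner value; its
    length is the source of \<open>2 * s\<close>.\<close>
  have a: "a 1 - s \<le> a j" "a j \<le> a 1 + s" for j using 0(1)[of 1 j] by linarith+
  then have "a 1 - s \<le> harmonic_approx n a x" "harmonic_approx n a x \<le> a 1 + s" for n
    using harmonic_approx_ge[of "a 1 - s" a] harmonic_approx_le[of a "a 1 + s"] 0(2) by blast+
  from this[of 0] this[of "Suc 0"] show ?case by (simp del: harmonic_approx.simps)
next
  case (Suc m)
  obtain i y where y: "x = F q i y" "y \<in> SG q" using Suc.prems SG_cases by blast
  then have "\<bar>harmonic_approx (Suc (Suc m)) a x - harmonic_approx (Suc m) a x\<bar> =
    \<bar>harmonic_approx (Suc m) (harmonic_restrict i a) y - harmonic_approx m (harmonic_restrict i a) y\<bar>"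
    by (simp only: harmonic_approx_F)
  also have "\<dots> \<le> (3/5) ^ m * (2 * (3/5 * s))"
    using Suc.prems y by (intro Suc.IH harmonic_restrict_oscillation) auto
  finally show ?case by (simp add: mult.assoc mult.left_commute)
qed

lemma continuous_on_harmonic_approx: "continuous_on (SG q) (harmonic_approx m a)"
proof (induction m arbitrary: a)
  case 0
  show ?case by (simp, intro continuous_intros continuous_on_bary)
next
  case (Suc m)
  have "continuous_on (F q i ` SG q) (harmonic_approx (Suc m) a)" for i
  proof -
    have "continuous_on (F q i ` SG q) (\<lambda>x. harmonic_approx m (harmonic_restrict i a) (2 *\<^sub>R x - q i))"
      by (intro continuous_on_compose2[OF Suc] continuous_intros) (auto simp: F_inverse_left)
    then show ?thesis
      by (rule continuous_on_eq) (auto simp: F_inverse_left harmonic_approx_F simp del: harmonic_approx.simps)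
  qed
  moreover have "closed (F q i ` SG q)" for i
    by (intro compact_imp_closed compact_continuous_image continuous_on_F compact_SG)
  ultimately have "continuous_on (\<Union>i. F q i ` SG q) (harmonic_approx (Suc m) a)"
    by (intro continuous_on_closed_Union) auto
  then show ?case by (simp only: SG_invariant[symmetric])
qed

definition harmonic :: "(3 \<Rightarrow> real) \<Rightarrow> real^2 \<Rightarrow> real" where
  "harmonic a x = (if x \<in> SG q then lim (\<lambda>m. harmonic_approx m a x) else 0)"

text \<open>The successive differences telescope and, by the oscillation estimate, are dominated by
  a geometric series with ratio 3/5.\<close>

lemma harmonic_uniform_limit: "uniform_limit (SG q) (\<lambda>m. harmonic_approx m a) (harmonic a) sequentially"
proof -
  let ?f = "\<lambda>n x. harmonic_approx (Suc n) a x - harmonic_approx n a x"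
  define s where "s = (\<Sum>j\<in>UNIV. \<Sum>k\<in>UNIV. \<bar>a j - a k\<bar>)"
  have s: "\<bar>a j - a k\<bar> \<le> s" for j k
  proof -
    have "\<bar>a j - a k\<bar> \<le> (\<Sum>k\<in>UNIV. \<bar>a j - a k\<bar>)" by (rule member_le_sum) auto
    also have "\<dots> \<le> s" unfolding s_def
      by (rule member_le_sum[of _ _ "\<lambda>j. \<Sum>k\<in>UNIV. \<bar>a j - a k\<bar>"]) (auto intro: sum_nonneg)
    finally show ?thesis .
  qed
  have tele: "(\<Sum>i<n. ?f i x) = harmonic_approx n a x - harmonic_approx 0 a x" for n x
    by (rule sum_lessThan_telescope)
  have "uniform_limit (SG q) (\<lambda>n x. \<Sum>i<n. ?f i x) (\<lambda>x. suminf (\<lambda>i. ?f i x)) sequentially"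
  proof (rule Weierstrass_m_test)
    show "norm (?f n x) \<le> (3/5) ^ n * (2 * s)" if "x \<in> SG q" for n x
      using harmonic_approx_step[OF s that, of n] by (simp del: harmonic_approx.simps)
    show "summable (\<lambda>n. (3/5) ^ n * (2 * s))"
      by (intro summable_mult2 summable_geometric) simp
  qed
  then have "uniform_limit (SG q) (\<lambda>n x. (\<Sum>i<n. ?f i x) + harmonic_approx 0 a x)
      (\<lambda>x. suminf (\<lambda>i. ?f i x) + harmonic_approx 0 a x) sequentially"
    by (intro uniform_limit_intros)
  then have *: "uniform_limit (SG q) (\<lambda>n. harmonic_approx n a)
      (\<lambda>x. suminf (\<lambda>i. ?f i x) + harmonic_approx 0 a x) sequentially"
    unfolding tele by simp
  moreover have "suminf (\<lambda>i. ?f i x) + harmonic_approx 0 a x = harmonic a x" if "x \<in> SG q" for x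
    using tendsto_uniform_limitI[OF * that] that by (simp add: harmonic_def limI)
  ultimately show ?thesis
    by (subst uniform_limit_cong'[of _ _ "\<lambda>n. harmonic_approx n a"
          _ "\<lambda>x. suminf (\<lambda>i. ?f i x) + harmonic_approx 0 a x"]) auto
qed

lemma harmonic_limit: "x \<in> SG q \<Longrightarrow> (\<lambda>m. harmonic_approx m a x) \<longlonglongrightarrow> harmonic a x"
  using harmonic_uniform_limit by (rule tendsto_uniform_limitI)

lemma continuous_on_harmonic: "continuous_on (SG q) (harmonic a)"
  by (rule uniform_limit_theorem[OF _ harmonic_uniform_limit])
    (simp_all add: continuous_on_harmonic_approx)

lemma harmonic_corner [simp]: "harmonic a (q j) = a j"
  using harmonic_limit[of "q j" a] by (simp add: harmonic_approx_corner LIMSEQ_const_iff)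

lemma harmonic_F:
  assumes "x \<in> SG q"
  shows "harmonic a (F q i x) = harmonic (harmonic_restrict i a) x"
proof (rule LIMSEQ_unique)
  show "(\<lambda>m. harmonic_approx (Suc m) a (F q i x)) \<longlonglongrightarrow> harmonic a (F q i x)"
    using harmonic_limit[of "F q i x" a] assms by (intro LIMSEQ_Suc) auto
  show "(\<lambda>m. harmonic_approx (Suc m) a (F q i x)) \<longlonglongrightarrow> harmonic (harmonic_restrict i a) x"
    unfolding harmonic_approx_F[OF assms] using assms by (rule harmonic_limit)
qed

lemma harmonic_uminus: "x \<in> SG q \<Longrightarrow> harmonic (\<lambda>j. - a j) x = - harmonic a x"
proof (rule LIMSEQ_unique)
  assume x: "x \<in> SG q"
  show "(\<lambda>m. harmonic_approx m (\<lambda>j. - a j) x) \<longlonglongrightarrow> harmonic (\<lambda>j. - a j) x"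
    using x by (rule harmonic_limit)
  show "(\<lambda>m. harmonic_approx m (\<lambda>j. - a j) x) \<longlonglongrightarrow> - harmonic a x"
    unfolding harmonic_approx_uminus using x by (intro tendsto_minus harmonic_limit)
qed

lemma harmonic_ge: "(\<And>j. c \<le> a j) \<Longrightarrow> x \<in> SG q \<Longrightarrow> c \<le> harmonic a x"
  by (rule LIMSEQ_le_const[OF harmonic_limit]) (auto intro: harmonic_approx_ge)

lemma harmonic_const: "x \<in> SG q \<Longrightarrow> harmonic (\<lambda>_. c) x = c"
  using harmonic_ge[of c "\<lambda>_. c" x] harmonic_ge[of "- c" "\<lambda>_. - c" x] harmonic_uminus[of x "\<lambda>_. c"]
  by simp

lemma harmonic_pos:
  assumes "\<And>j. 0 < a j" "x \<in> SG q"
  shows "0 < harmonic a x"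
proof -
  have "Min (range a) \<le> harmonic a x" using assms by (intro harmonic_ge) auto
  moreover have "0 < Min (range a)" using assms by auto
  ultimately show ?thesis by linarith
qed

text \<open>The graph energies do not depend on the level, since every refinement is a harmonic
  extension; finite energy follows at once.\<close>

lemma edge_form_harmonic:
  "edge_form q m (harmonic a) (harmonic a) = (\<Sum>j\<in>UNIV. \<Sum>k\<in>UNIV. (a j - a k)\<^sup>2) / 2"
proof (induction m arbitrary: a)
  case (Suc m)
  have "edge_form q m (\<lambda>x. harmonic a (F q i x)) (\<lambda>x. harmonic a (F q i x)) =
     edge_form q m (harmonic (harmonic_restrict i a)) (harmonic (harmonic_restrict i a))" for i
    by (rule edge_form_cong) (simp_all add: harmonic_F)
  then have "edge_form q (Suc m) (harmonic a) (harmonic a) = (5/3 * (\<Sum>i\<in>UNIV. \<Sum>j\<in>UNIV. \<Sum>k\<in>UNIV.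
      (harmonic_restrict i a j - harmonic_restrict i a k)\<^sup>2)) / 2"
    by (simp only: Suc edge_form.simps(2) sum_divide_distrib[symmetric] times_divide_eq_right)
  then show ?case by (simp only: harmonic_restrict_energy)
qed (simp add: power2_eq_square)

lemma harmonic_in_domE: "harmonic a \<in> domE q"
  unfolding domE_iff
  using continuous_on_harmonic energy_finiteI(1)[OF eq_refl[OF edge_form_harmonic]]
  by (auto simp: harmonic_def)

section \<open>Harmonic functions separate points\<close>

lemma halving_zero:
  assumes "\<And>n. dist x y \<le> D / 2 ^ n"
  shows "x = y"
proof -
  have "(\<lambda>n. D / 2 ^ n) \<longlonglongrightarrow> 0" by (rule LIMSEQ_divide_realpow_zero) simp
  then have "dist x y \<le> 0" using assms by (intro LIMSEQ_le_const) auto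
  then show ?thesis by simp
qed

text \<open>Strong minimum principle. In a cell \<open>i\<close> \<noteq> \<open>j\<close> all
  corner values are positive, which excludes the zero. So \<open>x\<close> lies in the cell at
  \<open>q j\<close>, where the new corner values have the same signs, and the argument repeats at
  half the scale.\<close>

lemma harmonic_zero_imp_corner:
  assumes "x \<in> SG q" "a j = 0" "\<And>k. k \<noteq> j \<Longrightarrow> 0 < a k" "harmonic a x \<le> 0"
  shows "x = q j"
proof -
  obtain D where D: "D > 0" "\<And>x y. x \<in> SG q \<Longrightarrow> y \<in> SG q \<Longrightarrow> dist x y \<le> D"
    using SG_bound by blast
  have "dist x (q j) \<le> D / 2 ^ n" for n
    using assms
  proof (induction n arbitrary: a x)
    case 0
    then show ?case using D by simp
  next
    case (Suc n)
    obtain i y where y: "x = F q i y" "y \<in> SG q" using Suc.prems(1) SG_cases by blast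
    have nonneg: "0 \<le> a k" for k using Suc.prems(2,3) by (cases "k = j") (auto intro: less_imp_le)
    have "sum a UNIV > 0"
    proof -
      obtain k where "k \<noteq> j" by (metis exhaust_3 num1_eq_iff zero_neq_one)
      then have "0 < a k" using Suc.prems(3) by blast
      also have "a k \<le> sum a UNIV" using nonneg by (intro member_le_sum) auto
      finally show ?thesis .
    qed
    then have pos: "k \<noteq> i \<Longrightarrow> 0 < harmonic_restrict i a k" for k
      using nonneg[of i] nonneg[of k] by (simp add: harmonic_restrict_def)
    have h: "harmonic (harmonic_restrict i a) y \<le> 0" using Suc.prems(4) y by (simp add: harmonic_F)
    have "i = j"
    proof (rule ccontr)
      assume "i \<noteq> j"
      then have "0 < harmonic_restrict i a k" for k
        using pos[of k] Suc.prems(3)[of i] by (cases "k = i") auto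
      then show False using harmonic_pos[of "harmonic_restrict i a" y] y h by simp
    qed
    then have "dist y (q j) \<le> D / 2 ^ n"
      using Suc.IH[of y "harmonic_restrict i a"] y h pos Suc.prems(2) by simp
    moreover have "dist x (q j) = dist y (q j) / 2"
      using F_dist[of q j y "q j"] y \<open>i = j\<close> by simp
    ultimately show ?case by simp
  qed
  then show ?thesis by (rule halving_zero)
qed

text \<open>Points that no harmonic function tells apart either lie in a common cell, where the
  hypothesis persists and the distance doubles on rescaling, or in two different cells, where one
  antisymmetric function forces both to be the junction point.\<close>

lemma harmonic_separates:
  assumes "x \<in> SG q" "y \<in> SG q" "\<And>a. harmonic a x = harmonic a y"
  shows "x = y"
proof -
  obtain D where D: "D > 0" "\<And>x y. x \<in> SG q \<Longrightarrow> y \<in> SG q \<Longrightarrow> dist x y \<le> D"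
    using SG_bound by blast
  have "dist x y \<le> D / 2 ^ n" for n
    using assms
  proof (induction n arbitrary: x y)
    case 0
    then show ?case using D by simp
  next
    case (Suc n)
    obtain i x' where x: "x = F q i x'" "x' \<in> SG q" using Suc.prems(1) SG_cases by blast
    obtain j y' where y: "y = F q j y'" "y' \<in> SG q" using Suc.prems(2) SG_cases by blast
    have h: "harmonic (harmonic_restrict i a) x' = harmonic (harmonic_restrict j a) y'" for a
      using Suc.prems(3)[of a] x y by (simp add: harmonic_F)
    show ?case
    proof (cases "i = j")
      case True
      have "harmonic b x' = harmonic b y'" for b
        using h harmonic_restrict_surj[of i b] True by metis
      then have "dist x' y' \<le> D / 2 ^ n" using Suc.IH x y by blast
      then show ?thesis using x y True by (simp add: F_dist)
    next
      case False
      \<comment> \<open>This function is nonnegative on cell \<open>i\<close> and nonpositive on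
        cell \<open>j\<close>; the midpoint shared by them is its only zero in either cell. Equal
        values at \<open>x\<close> and \<open>y\<close> must therefore be zero.\<close>
      define a :: "3 \<Rightarrow> real" where "a k = (if k = i then 1 else if k = j then -1 else 0)" for k
      have "sum a UNIV = 0"
        using False exhaust_3[of i] exhaust_3[of j] by (auto simp: sum_3 a_def)
      then have ai: "harmonic_restrict i a k = (if k = i then 1 else if k = j then 0 else 1/5)"
        and aj: "- harmonic_restrict j a k = (if k = j then 1 else if k = i then 0 else 1/5)" for k
        using False by (auto simp: harmonic_restrict_def a_def)
      let ?b = "\<lambda>k. - harmonic_restrict j a k"
      have "0 \<le> harmonic (harmonic_restrict i a) x'" "0 \<le> harmonic ?b y'"
        using x y by (intro harmonic_ge; simp add: ai aj)+
      moreover have "harmonic (harmonic_restrict i a) x' = - harmonic ?b y'"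
        using h[of a] harmonic_uminus[of y' "harmonic_restrict j a"] y by simp
      ultimately have "harmonic (harmonic_restrict i a) x' \<le> 0" "harmonic ?b y' \<le> 0" by linarith+
      then have "x' = q j" "y' = q i"
        using harmonic_zero_imp_corner[of x' "harmonic_restrict i a" j]
          harmonic_zero_imp_corner[of y' ?b i] x y False by (simp_all add: ai aj)
      then show ?thesis using x y D F_corner_commute by simp
    qed
  qed
  then show ?thesis by (rule halving_zero)
qed

section \<open>Finite energy functions with prescribed zeros\<close>

lemma domE_mult: "u \<in> domE q \<Longrightarrow> v \<in> domE q \<Longrightarrow> (\<lambda>x. u x * v x) \<in> domE q"
  unfolding domE_iff by (auto intro: continuous_intros energy_finite_mult)

lemma domE_diff: "u \<in> domE q \<Longrightarrow> v \<in> domE q \<Longrightarrow> (\<lambda>x. u x - v x) \<in> domE q"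
  unfolding domE_iff by (auto intro: continuous_intros energy_finite_diff)

lemma domE_add: "u \<in> domE q \<Longrightarrow> v \<in> domE q \<Longrightarrow> (\<lambda>x. u x + v x) \<in> domE q"
  unfolding domE_iff by (auto intro: continuous_intros energy_finite_add)

lemma domE_scale: "u \<in> domE q \<Longrightarrow> (\<lambda>x. c * u x) \<in> domE q"
  unfolding domE_iff by (auto intro: continuous_intros energy_finite_scale)

lemma domE_separates:
  assumes "x \<in> SG q" "y \<in> SG q" "x \<noteq> y"
  shows "\<exists>u\<in>domE q. u x = 0 \<and> u y = 1"
proof -
  obtain a where a: "harmonic a x \<noteq> harmonic a y" using harmonic_separates assms by blast
  let ?c = "harmonic a x"
  \<comment> \<open>The constant is entered as a harmonic function with constant corner values,
    because a literal constant would not vanish off the gasket.\<close>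
  have "(\<lambda>z. 1 / (harmonic a y - ?c) * (harmonic a z - harmonic (\<lambda>_. ?c) z)) \<in> domE q"
    by (intro domE_scale domE_diff harmonic_in_domE)
  then show ?thesis
    using a assms by (intro bexI) (auto simp: harmonic_const)
qed

lemma domE_bump:
  assumes "finite E" "E \<subseteq> SG q" "y \<in> SG q" "y \<notin> E"
  shows "\<exists>u\<in>domE q. (\<forall>x\<in>E. u x = 0) \<and> u y = 1"
  using assms
proof (induction E rule: finite_induct)
  case empty
  show ?case
    by (rule bexI[of _ "harmonic (\<lambda>_. 1)"]) (auto simp: harmonic_const harmonic_in_domE empty)
next
  case (insert x E)
  then obtain u where u: "u \<in> domE q" "\<forall>x\<in>E. u x = 0" "u y = 1" by auto
  obtain v where v: "v \<in> domE q" "v x = 0" "v y = 1"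
    using domE_separates[of x y] insert.prems by blast
  have "(\<lambda>z. u z * v z) \<in> domE q" using u v by (intro domE_mult)
  then show ?case using u v by (intro bexI) auto
qed

text \<open>Counting the corners among the zeros yields the Dirichlet condition, so \<open>y\<close>
  itself must not be a corner.\<close>

lemma domE0_bump:
  assumes "finite E" "E \<subseteq> SG q" "y \<in> SG q - V0 q" "y \<notin> E"
  shows "\<exists>u\<in>domE0 q. (\<forall>x\<in>E. u x = 0) \<and> u y = 1"
proof -
  have "\<exists>u\<in>domE q. (\<forall>x\<in>E \<union> range q. u x = 0) \<and> u y = 1"
    using assms by (intro domE_bump) (auto simp: V0_def)
  then show ?thesis by (auto simp: domE0_iff)
qed

end

section \<open>Interpolation in a reproducing kernel Hilbert space of functions\<close>

text \<open>\<open>bound\<close> does double duty: it makes point evaluations continuous and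
  \<open>B\<close> definite. Completeness is phrased through \<open>B\<close> of differences,
  because \<open>H\<close> is a mere set of functions without a norm of its own.\<close>

locale reproducing_form =
  fixes H :: "('a \<Rightarrow> real) set" and B :: "('a \<Rightarrow> real) \<Rightarrow> ('a \<Rightarrow> real) \<Rightarrow> real" and C :: real
  assumes zero_mem: "(\<lambda>_. 0) \<in> H"
    and add_mem: "u \<in> H \<Longrightarrow> v \<in> H \<Longrightarrow> (\<lambda>x. u x + v x) \<in> H"
    and scale_mem: "u \<in> H \<Longrightarrow> (\<lambda>x. c * u x) \<in> H"
    and sym: "u \<in> H \<Longrightarrow> v \<in> H \<Longrightarrow> B u v = B v u"
    and add_left: "u \<in> H \<Longrightarrow> v \<in> H \<Longrightarrow> w \<in> H \<Longrightarrow> B (\<lambda>x. u x + v x) w = B u w + B v w"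
    and scale_left: "u \<in> H \<Longrightarrow> w \<in> H \<Longrightarrow> B (\<lambda>x. c * u x) w = c * B u w"
    and nonneg: "u \<in> H \<Longrightarrow> 0 \<le> B u u"
    and bound: "u \<in> H \<Longrightarrow> \<bar>u x\<bar> \<le> C * sqrt (B u u)"
    and complete: "(\<And>n :: nat. s n \<in> H) \<Longrightarrow>
      (\<And>e. e > 0 \<Longrightarrow> \<exists>N. \<forall>m\<ge>N. \<forall>n\<ge>N. B (\<lambda>x. s m x - s n x) (\<lambda>x. s m x - s n x) \<le> e) \<Longrightarrow>
      \<exists>v\<in>H. (\<lambda>n. B (\<lambda>x. s n x - v x) (\<lambda>x. s n x - v x)) \<longlonglongrightarrow> 0"
begin

lemma diff_mem: "u \<in> H \<Longrightarrow> v \<in> H \<Longrightarrow> (\<lambda>x. u x - v x) \<in> H"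
  using add_mem[of u "\<lambda>x. (-1) * v x"] scale_mem[of v "-1"] by simp

lemma diff_left: "u \<in> H \<Longrightarrow> v \<in> H \<Longrightarrow> w \<in> H \<Longrightarrow> B (\<lambda>x. u x - v x) w = B u w - B v w"
  using add_left[of u "\<lambda>x. (-1) * v x" w] scale_left[of v w "-1"] scale_mem[of v "-1"] by simp

lemma add_right: "u \<in> H \<Longrightarrow> v \<in> H \<Longrightarrow> w \<in> H \<Longrightarrow> B w (\<lambda>x. u x + v x) = B w u + B w v"
  using add_left[of u v w] by (simp add: sym add_mem)

lemma diff_right: "u \<in> H \<Longrightarrow> v \<in> H \<Longrightarrow> w \<in> H \<Longrightarrow> B w (\<lambda>x. u x - v x) = B w u - B w v"
  using diff_left[of u v w] by (simp add: sym diff_mem)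

lemma scale_right: "u \<in> H \<Longrightarrow> w \<in> H \<Longrightarrow> B w (\<lambda>x. c * u x) = c * B w u"
  using scale_left[of u w c] by (simp add: sym scale_mem)

lemma definite: "u \<in> H \<Longrightarrow> B u u = 0 \<Longrightarrow> u = (\<lambda>_. 0)"
  using bound[of u] by (auto simp: fun_eq_iff)

lemma sum_mem: "(\<And>i. i \<in> I \<Longrightarrow> u i \<in> H) \<Longrightarrow> (\<lambda>x. \<Sum>i\<in>I. u i x) \<in> H"
  by (induction I rule: infinite_finite_induct) (auto intro: zero_mem add_mem)

lemma zero_left: "w \<in> H \<Longrightarrow> B (\<lambda>_. 0) w = 0"
  using scale_left[OF zero_mem, of w 0] by simp

lemma sum_left: "(\<And>i. i \<in> I \<Longrightarrow> u i \<in> H) \<Longrightarrow> w \<in> H \<Longrightarrow> B (\<lambda>x. \<Sum>i\<in>I. u i x) w = (\<Sum>i\<in>I. B (u i) w)"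
  by (induction I rule: infinite_finite_induct) (auto simp: zero_left add_left sum_mem)

lemma diff_expand:
  "u \<in> H \<Longrightarrow> w \<in> H \<Longrightarrow>
    B (\<lambda>x. u x - t * w x) (\<lambda>x. u x - t * w x) = B u u - 2 * t * B u w + t\<^sup>2 * B w w"
  by (simp add: diff_left diff_right scale_left scale_right diff_mem scale_mem sym[of w u]
      power2_eq_square algebra_simps)

text \<open>With \<open>c = B u u\<close> this is the Cauchy--Schwarz inequality, with \<open>c = 0\<close>
  the orthogonality of a minimizer to the admissible variations.\<close>

lemma min_orthogonal:
  assumes "u \<in> H" "w \<in> H" "\<And>t. B u u \<le> c + B (\<lambda>x. u x - t * w x) (\<lambda>x. u x - t * w x)"
  shows "(B u w)\<^sup>2 \<le> c * B w w"
proof (cases "B w w = 0")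
  case True
  then have "w = (\<lambda>_. 0)" using definite assms by blast
  then show ?thesis using zero_left[OF assms(1)] sym[OF assms(1,2)] True by simp
next
  case False
  then have pos: "B w w > 0" using nonneg[OF assms(2)] by simp
  have "0 \<le> c - 2 * (B u w / B w w) * B u w + (B u w / B w w)\<^sup>2 * B w w"
    using assms(3)[of "B u w / B w w"] unfolding diff_expand[OF assms(1,2)] by linarith
  also have "\<dots> = c - (B u w)\<^sup>2 / B w w" using pos by (simp add: power2_eq_square field_simps)
  finally show ?thesis using pos by (simp add: field_simps)
qed

lemma Cauchy_Schwarz: "u \<in> H \<Longrightarrow> w \<in> H \<Longrightarrow> (B u w)\<^sup>2 \<le> B u u * B w w"
  by (rule min_orthogonal) (auto intro!: nonneg diff_mem scale_mem)

text \<open>Written with the midpoint, since the midpoint of two functions with the prescribed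
  values has these values again.\<close>

lemma parallelogram:
  "u \<in> H \<Longrightarrow> v \<in> H \<Longrightarrow> B (\<lambda>x. u x - v x) (\<lambda>x. u x - v x) =
    2 * B u u + 2 * B v v - 4 * B (\<lambda>x. (1/2) * (u x + v x)) (\<lambda>x. (1/2) * (u x + v x))"
proof -
  assume uv: "u \<in> H" "v \<in> H"
  have "B (\<lambda>x. (1/2) * (u x + v x)) (\<lambda>x. (1/2) * (u x + v x)) =
      (1/4) * B (\<lambda>x. u x + v x) (\<lambda>x. u x + v x)"
    using scale_left[OF add_mem[OF uv] scale_mem[OF add_mem[OF uv], of "1/2"], of "1/2"]
      scale_right[OF add_mem[OF uv] add_mem[OF uv], of "1/2"] by simp
  then show ?thesis
    using uv by (simp add: diff_left diff_right add_left add_right diff_mem add_mem sym[of v u])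
qed

lemma minimizer_exists:
  assumes "{u \<in> H. \<forall>i\<in>I. u (x i) = a i} \<noteq> {}" (is "?A \<noteq> {}")
  obtains v where "v \<in> H" "\<And>i. i \<in> I \<Longrightarrow> v (x i) = a i"
    "\<And>u. u \<in> H \<Longrightarrow> (\<And>i. i \<in> I \<Longrightarrow> u (x i) = a i) \<Longrightarrow> B v v \<le> B u u"
proof -
  define d where "d = (INF u\<in>?A. B u u)"
  have bdd: "bdd_below ((\<lambda>u. B u u) ` ?A)"
    using nonneg by (auto simp: bdd_below_def)
  have d_le: "d \<le> B u u" if "u \<in> ?A" for u
    unfolding d_def by (rule cINF_lower[OF bdd that])
  have "\<forall>n. \<exists>u. u \<in> ?A \<and> B u u < d + 1 / Suc n"
  proof
    fix n
    have "(INF u\<in>?A. B u u) < d + 1 / Suc n" by (simp add: d_def)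
    then show "\<exists>u. u \<in> ?A \<and> B u u < d + 1 / Suc n"
      unfolding cINF_less_iff[OF assms bdd] by blast
  qed
  from choice[OF this] obtain u
    where u: "\<And>n. u n \<in> ?A" "\<And>n. B (u n) (u n) < d + 1 / Suc n" by blast
  have uH: "u n \<in> H" for n using u(1)[of n] by simp
  have cauchy: "B (\<lambda>x. u m x - u n x) (\<lambda>x. u m x - u n x) \<le> 2 / Suc m + 2 / Suc n" for m n
  proof -
    \<comment> \<open>The midpoint competes in the infimum, so four times its form is at least
      \<open>4 * d\<close>; this cancels the leading terms of the parallelogram identity and leaves
      the two errors.\<close>
    let ?w = "\<lambda>x. (1/2) * (u m x + u n x)"
    have "?w \<in> H" by (intro scale_mem add_mem uH)
    moreover have "\<forall>i\<in>I. ?w (x i) = a i" using u(1)[of m] u(1)[of n] by simp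
    ultimately have "d \<le> B ?w ?w" by (intro d_le) blast
    moreover have "2 / real (Suc k) = 2 * (1 / real (Suc k))" for k by simp
    ultimately show ?thesis
      using parallelogram[OF uH[of m] uH[of n]] u(2)[of m] u(2)[of n] by linarith
  qed
  have "\<exists>v\<in>H. (\<lambda>n. B (\<lambda>x. u n x - v x) (\<lambda>x. u n x - v x)) \<longlonglongrightarrow> 0"
  proof (rule complete[OF uH])
    fix e :: real assume "e > 0"
    then obtain N where N: "1 / real (Suc N) < e / 4" using nat_approx_posE[of "e/4"] by auto
    have "2 / real (Suc m) \<le> e / 2" if "m \<ge> N" for m
    proof -
      have "1 / real (Suc m) \<le> 1 / real (Suc N)" using that by (intro divide_left_mono) auto
      then show ?thesis using N by simp
    qed
    then have "B (\<lambda>x. u m x - u n x) (\<lambda>x. u m x - u n x) \<le> e" if "m \<ge> N" "n \<ge> N" for m n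
      using cauchy[of m n] that by (smt (verit) field_sum_of_halves)
    then show "\<exists>N. \<forall>m\<ge>N. \<forall>n\<ge>N. B (\<lambda>x. u m x - u n x) (\<lambda>x. u m x - u n x) \<le> e"
      by blast
  qed
  then obtain v where v: "v \<in> H" "(\<lambda>n. B (\<lambda>x. u n x - v x) (\<lambda>x. u n x - v x)) \<longlonglongrightarrow> 0" by blast
  define D where "D n = B (\<lambda>x. u n x - v x) (\<lambda>x. u n x - v x)" for n
  have D: "D \<longlonglongrightarrow> 0" using v(2) by (simp add: D_def[abs_def])
  have D_nonneg: "0 \<le> D n" for n unfolding D_def by (intro nonneg diff_mem uH v)
  have va: "v (x i) = a i" if "i \<in> I" for i
  proof -
    have "(\<lambda>n. C * sqrt (D n)) \<longlonglongrightarrow> C * sqrt 0" using D by (intro tendsto_intros)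
    then have "(\<lambda>n. C * sqrt (D n)) \<longlonglongrightarrow> 0" by simp
    moreover have "\<bar>a i - v (x i)\<bar> \<le> C * sqrt (D n)" for n
      using bound[OF diff_mem[OF uH v(1)], of n "x i"] u(1)[of n] that by (simp add: D_def)
    ultimately have "\<bar>a i - v (x i)\<bar> \<le> 0" by (intro LIMSEQ_le_const) auto
    then show ?thesis by simp
  qed
  have "B v v \<le> d"
  proof -
    have le: "B v v \<le> (d + 1 / Suc n) + 2 * sqrt ((d + 1 / Suc n) * D n) + D n" for n
    proof -
      let ?w = "\<lambda>x. u n x - v x"
      have w: "?w \<in> H" by (intro diff_mem uH v)
      \<comment> \<open>\<open>v\<close> is \<open>u n\<close> minus the deviation
        \<open>?w\<close>. The cross term tends to 0 by the Cauchy--Schwarz inequality, as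
        \<open>B (u n) (u n)\<close> stays bounded.\<close>
      have "B v v = B (u n) (u n) - 2 * B (u n) ?w + D n"
        using diff_expand[OF uH w, of n 1] by (simp add: D_def)
      moreover have "- B (u n) ?w \<le> sqrt ((d + 1 / Suc n) * D n)"
      proof -
        have "(- B (u n) ?w)\<^sup>2 \<le> B (u n) (u n) * D n"
          using Cauchy_Schwarz[OF uH w, of n] by (simp add: D_def)
        also have "\<dots> \<le> (d + 1 / Suc n) * D n"
          using u(2)[of n] D_nonneg[of n] by (intro mult_right_mono) auto
        finally show ?thesis by (rule real_le_rsqrt)
      qed
      ultimately show ?thesis using u(2)[of n] by linarith
    qed
    have "(\<lambda>n. (d + 1 / Suc n) + 2 * sqrt ((d + 1 / Suc n) * D n) + D n)
        \<longlonglongrightarrow> (d + 0) + 2 * sqrt ((d + 0) * 0) + 0"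
      using D LIMSEQ_Suc[OF lim_1_over_n] by (intro tendsto_intros) auto
    then show ?thesis using le by (intro LIMSEQ_le_const) auto
  qed
  then show ?thesis
    using that[of v] v(1) va d_le by (smt (verit) mem_Collect_eq)
qed

section \<open>Kernels and interpolation\<close>

definition reproduces :: "'a \<Rightarrow> ('a \<Rightarrow> real) \<Rightarrow> bool" where
  "reproduces y g \<longleftrightarrow> g \<in> H \<and> (\<forall>v\<in>H. B g v = v y)"

text \<open>The pole comes first, opposite to \<open>resolvent_kernel\<close>, so that
  \<open>kernel y\<close> is itself an element of \<open>H\<close>.\<close>

definition kernel :: "'a \<Rightarrow> 'a \<Rightarrow> real" where
  "kernel y = (THE g. reproduces y g)"

lemma eqI:
  assumes "f \<in> H" "g \<in> H" "\<And>v. v \<in> H \<Longrightarrow> B f v = B g v"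
  shows "f = g"
proof -
  have "B (\<lambda>x. f x - g x) (\<lambda>x. f x - g x) = 0"
    using assms diff_mem[of f g] by (simp add: diff_left)
  then have "(\<lambda>x. f x - g x) = (\<lambda>_. 0)" using definite assms diff_mem by blast
  then show ?thesis by (simp add: fun_eq_iff)
qed

lemma kernelI: "reproduces y g \<Longrightarrow> reproduces y (kernel y)"
  unfolding kernel_def by (rule theI[of _ g]) (auto simp: reproduces_def intro: eqI)

lemma minimizer_represents:
  assumes "finite I" and b: "\<And>i. i \<in> I \<Longrightarrow> b i \<in> H"
    and delta: "\<And>i j. i \<in> I \<Longrightarrow> j \<in> I \<Longrightarrow> b i (x j) = (if i = j then 1 else 0)"
  obtains v where "v \<in> H" "\<And>i. i \<in> I \<Longrightarrow> v (x i) = a i"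
    "\<And>w. w \<in> H \<Longrightarrow> B v w = (\<Sum>i\<in>I. B v (b i) * w (x i))"
proof -
  have interp: "(\<Sum>i\<in>I. c i * b i (x j)) = c j" if "j \<in> I" for j and c :: "'b \<Rightarrow> real"
  proof -
    have "(\<Sum>i\<in>I. c i * b i (x j)) = (\<Sum>i\<in>I. if i = j then c i else 0)"
      using that delta by (intro sum.cong) auto
    then show ?thesis using that assms(1) by simp
  qed
  have mem: "(\<lambda>y. \<Sum>i\<in>I. c i * b i y) \<in> H" for c
    by (intro sum_mem scale_mem b)
  have "(\<lambda>y. \<Sum>i\<in>I. a i * b i y) \<in> {u \<in> H. \<forall>i\<in>I. u (x i) = a i}"
    using mem interp by simp
  then obtain v where v: "v \<in> H" "\<And>i. i \<in> I \<Longrightarrow> v (x i) = a i"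
    "\<And>u. u \<in> H \<Longrightarrow> (\<And>i. i \<in> I \<Longrightarrow> u (x i) = a i) \<Longrightarrow> B v v \<le> B u u"
    using minimizer_exists[of I x a] by blast
  have "B v w = (\<Sum>i\<in>I. B v (b i) * w (x i))" if w: "w \<in> H" for w
  proof -
    let ?s = "\<lambda>y. \<Sum>i\<in>I. w (x i) * b i y"
    \<comment> \<open>Subtracting the dual combination removes the node values of \<open>w\<close>.
      Variations of \<open>v\<close> along \<open>?r\<close> therefore stay admissible for every
      \<open>t\<close>, and \<open>v\<close> is orthogonal to \<open>?r\<close>.\<close>
    let ?r = "\<lambda>y. w y - ?s y"
    have r: "?r \<in> H" by (intro diff_mem w mem)
    have "(B v ?r)\<^sup>2 \<le> 0 * B ?r ?r"
    proof (rule min_orthogonal[OF v(1) r])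
      fix t
      have "B v v \<le> B (\<lambda>x. v x - t * ?r x) (\<lambda>x. v x - t * ?r x)"
      proof (rule v(3))
        show "(\<lambda>x. v x - t * ?r x) \<in> H" by (intro diff_mem scale_mem v(1) r)
        show "v (x i) - t * ?r (x i) = a i" if "i \<in> I" for i
          using interp[OF that, of "\<lambda>i. w (x i)"] v(2)[OF that] by simp
      qed
      then show "B v v \<le> 0 + B (\<lambda>x. v x - t * ?r x) (\<lambda>x. v x - t * ?r x)" by simp
    qed
    then have "B v w = B v ?s" using diff_right[OF w mem v(1)] by simp
    also have "\<dots> = B ?s v" by (rule sym[OF v(1) mem])
    also have "\<dots> = (\<Sum>i\<in>I. B (\<lambda>y. w (x i) * b i y) v)" by (intro sum_left scale_mem b v)
    also have "\<dots> = (\<Sum>i\<in>I. B v (b i) * w (x i))"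
      using b v(1) by (intro sum.cong) (auto simp: scale_left sym)
    finally show ?thesis .
  qed
  then show ?thesis using that v by blast
qed

text \<open>The minimizer with value 1 at \<open>y\<close> represents a multiple of the evaluation
  at \<open>y\<close>. The multiple is \<open>B v b\<close>; testing with \<open>v\<close> itself
  shows that it equals \<open>B v v\<close>, which is not 0, so it can be divided out.\<close>

lemma reproduces_kernel:
  assumes "b \<in> H" "b y = 1"
  shows "reproduces y (kernel y)"
proof -
  obtain v where v: "v \<in> H" "v y = 1" "\<And>w. w \<in> H \<Longrightarrow> B v w = B v b * w y"
    using minimizer_represents[of "{()}" "\<lambda>_. b" "\<lambda>_. y" "\<lambda>_. 1"] assms by auto
  have "B v v = B v b" using v(3)[OF v(1)] v(2) by simp
  moreover have "B v v \<noteq> 0" using definite[OF v(1)] v(2) by auto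
  ultimately have "reproduces y (\<lambda>x. (1 / B v b) * v x)"
    using v(1) v(3) unfolding reproduces_def by (auto simp only: scale_left intro: scale_mem) auto
  then show ?thesis by (rule kernelI)
qed

theorem interpolation:
  assumes "finite I" and b: "\<And>i. i \<in> I \<Longrightarrow> b i \<in> H"
    and delta: "\<And>i j. i \<in> I \<Longrightarrow> j \<in> I \<Longrightarrow> b i (x j) = (if i = j then 1 else 0)"
  shows "\<exists>!c. c \<in> I \<rightarrow>\<^sub>E (UNIV :: real set) \<and> (\<forall>i\<in>I. (\<Sum>j\<in>I. c j * kernel (x j) (x i)) = a i)"
    and "f = (\<lambda>y. \<Sum>j\<in>I. c j * kernel (x j) y) \<Longrightarrow> \<forall>i\<in>I. f (x i) = a i \<Longrightarrow>
      is_arg_min (\<lambda>u. B u u) (\<lambda>v. v \<in> H \<and> (\<forall>i\<in>I. v (x i) = a i)) u \<longleftrightarrow> u = f"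
proof -
  have K: "kernel (x i) \<in> H" "v \<in> H \<Longrightarrow> B (kernel (x i)) v = v (x i)" if "i \<in> I" for i v
    using reproduces_kernel[OF b[OF that]] delta[OF that that] by (auto simp: reproduces_def)
  have mem: "(\<lambda>y. \<Sum>j\<in>I. c j * kernel (x j) y) \<in> H" for c
    by (intro sum_mem scale_mem K)
  have B_comb: "B (\<lambda>y. \<Sum>j\<in>I. c j * kernel (x j) y) v = (\<Sum>j\<in>I. c j * v (x j))" if "v \<in> H" for c v
    using that K by (simp add: sum_left scale_left scale_mem)
  show "\<exists>!c. c \<in> I \<rightarrow>\<^sub>E (UNIV :: real set) \<and> (\<forall>i\<in>I. (\<Sum>j\<in>I. c j * kernel (x j) (x i)) = a i)"
  proof (rule ex_ex1I)
    obtain v where v: "v \<in> H" "\<And>i. i \<in> I \<Longrightarrow> v (x i) = a i"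
      "\<And>w. w \<in> H \<Longrightarrow> B v w = (\<Sum>i\<in>I. B v (b i) * w (x i))"
      using minimizer_represents[OF assms] by blast
    \<comment> \<open>The minimizer and the kernel combination with these coefficients represent the
      same functional, so they coincide. Restriction fixes the coefficients off \<open>I\<close>,
      where uniqueness could not hold otherwise.\<close>
    let ?c = "restrict (\<lambda>i. B v (b i)) I"
    have "v = (\<lambda>y. \<Sum>j\<in>I. ?c j * kernel (x j) y)"
      by (rule eqI[OF v(1) mem]) (simp add: v(3) B_comb del: restrict_apply cong: sum.cong, simp)
    then have "\<forall>i\<in>I. (\<Sum>j\<in>I. ?c j * kernel (x j) (x i)) = a i" using v(2) by metis
    then show "\<exists>c. c \<in> I \<rightarrow>\<^sub>E (UNIV :: real set) \<and> (\<forall>i\<in>I. (\<Sum>j\<in>I. c j * kernel (x j) (x i)) = a i)"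
      by (intro exI[of _ ?c]) auto
  next
    fix c c'
    assume c: "c \<in> I \<rightarrow>\<^sub>E (UNIV :: real set) \<and> (\<forall>i\<in>I. (\<Sum>j\<in>I. c j * kernel (x j) (x i)) = a i)"
      and c': "c' \<in> I \<rightarrow>\<^sub>E (UNIV :: real set) \<and> (\<forall>i\<in>I. (\<Sum>j\<in>I. c' j * kernel (x j) (x i)) = a i)"
    define g where "g = (\<lambda>y. \<Sum>j\<in>I. (c j - c' j) * kernel (x j) y)"
    have g: "g \<in> H" unfolding g_def by (rule mem)
    have gB: "B g v = (\<Sum>j\<in>I. (c j - c' j) * v (x j))" if "v \<in> H" for v
      unfolding g_def by (rule B_comb[OF that])
    have "g (x i) = 0" if "i \<in> I" for i
      using c c' that by (simp add: g_def left_diff_distrib sum_subtractf)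
    then have "B g g = 0" using gB[OF g] by simp
    then have "g = (\<lambda>_. 0)" using definite g by blast
    then have *: "(\<Sum>j\<in>I. (c j - c' j) * b i (x j)) = 0" if "i \<in> I" for i
      using gB[OF b[OF that]] zero_left[OF b[OF that]] by simp
    have "c i = c' i" if "i \<in> I" for i
    proof -
      have "(\<Sum>j\<in>I. (c j - c' j) * b i (x j)) = (\<Sum>j\<in>I. if i = j then c j - c' j else 0)"
        using that delta by (intro sum.cong) auto
      then show ?thesis using *[OF that] that assms(1) by simp
    qed
    then show "c = c'" using c c' by (blast intro: PiE_ext)
  qed
  assume f: "f = (\<lambda>y. \<Sum>j\<in>I. c j * kernel (x j) y)" and fa: "\<forall>i\<in>I. f (x i) = a i"
  have fH: "f \<in> H" unfolding f by (rule mem)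
  have pyth: "B v v = B f f + B (\<lambda>y. v y - f y) (\<lambda>y. v y - f y)"
    if "v \<in> H" "\<forall>i\<in>I. v (x i) = a i" for v
  proof -
    have d: "(\<lambda>y. v y - f y) \<in> H" using that fH by (intro diff_mem)
    \<comment> \<open>\<open>B f\<close> sees only node values, and \<open>v\<close> and
      \<open>f\<close> agree at the nodes. This orthogonality is what makes the Pythagorean identity
      hold.\<close>
    have "B f (\<lambda>y. v y - f y) = 0"
      using that fa by (simp add: f B_comb[OF d[unfolded f]])
    then have "B f v = B f f" using diff_right[OF that(1) fH fH] by simp
    then show ?thesis
      using that fH d by (simp add: diff_left diff_right sym[of v f])
  qed
  show "is_arg_min (\<lambda>u. B u u) (\<lambda>v. v \<in> H \<and> (\<forall>i\<in>I. v (x i) = a i)) u \<longleftrightarrow> u = f"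
  proof
    assume u: "is_arg_min (\<lambda>u. B u u) (\<lambda>v. v \<in> H \<and> (\<forall>i\<in>I. v (x i) = a i)) u"
    then have uH: "u \<in> H" "\<forall>i\<in>I. u (x i) = a i" and "\<not> B f f < B u u"
      using fH fa by (auto simp: is_arg_min_def)
    then have "B (\<lambda>y. u y - f y) (\<lambda>y. u y - f y) = 0"
      using pyth[OF uH] nonneg[OF diff_mem[OF uH(1) fH]] by linarith
    then have "(\<lambda>y. u y - f y) = (\<lambda>_. 0)" using definite diff_mem[OF uH(1) fH] by blast
    then show "u = f" by (simp add: fun_eq_iff)
  next
    assume "u = f"
    moreover have "\<not> B v v < B f f" if "v \<in> H" "\<forall>i\<in>I. v (x i) = a i" for v
      using pyth[OF that] nonneg[OF diff_mem[OF that(1) fH]] by linarith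
    ultimately show "is_arg_min (\<lambda>u. B u u) (\<lambda>v. v \<in> H \<and> (\<forall>i\<in>I. v (x i) = a i)) u"
      using fH fa by (auto simp: is_arg_min_def)
  qed
qed

end

section \<open>The resolvent form on the gasket\<close>

text \<open>A graph energy involves finitely many point values, so pointwise convergence is enough.
  In the completeness proof this plays the part of Fatou's lemma.\<close>

lemma edge_form_tendsto_pointwise:
  assumes "\<And>x. (\<lambda>k. f k x) \<longlonglongrightarrow> g x"
  shows "(\<lambda>k. edge_form q m (f k) (f k)) \<longlonglongrightarrow> edge_form q m g g"
  using assms
proof (induction m arbitrary: f g)
  case 0
  then show ?case by (auto intro!: tendsto_intros)
next
  case (Suc m)
  show ?case
    unfolding edge_form.simps by (intro tendsto_mult tendsto_const tendsto_sum Suc)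
qed

context gasket
begin

lemma set_integrable_SG:
  fixes f :: "real^2 \<Rightarrow> real"
  assumes "continuous_on (SG q) f"
  shows "set_integrable (SG_measure q) (SG q) f"
proof -
  interpret prob_space "SG_measure q" by (rule prob_space_SG_measure)
  obtain M where M: "\<And>x. x \<in> SG q \<Longrightarrow> \<bar>f x\<bar> \<le> M"
    using compact_imp_bounded[OF compact_continuous_image[OF assms compact_SG]]
    by (auto simp: bounded_iff)
  have "(\<lambda>x. indicator (SG q) x *\<^sub>R f x) \<in> borel_measurable borel"
    using assms closed_SG by (intro borel_measurable_continuous_on_indicator) auto
  then have meas: "(\<lambda>x. indicator (SG q) x *\<^sub>R f x) \<in> borel_measurable (SG_measure q)"
    using measurable_cong_sets[OF sets_SG_measure refl] by blast
  have "\<bar>indicator (SG q) x *\<^sub>R f x\<bar> \<le> max 0 M" for x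
    using M[of x] by (auto simp: indicator_def)
  then show ?thesis
    unfolding set_integrable_def
    by (intro integrable_const_bound[OF _ meas, of "max 0 M"]) auto
qed

definition resolvent_form :: "real \<Rightarrow> (real^2 \<Rightarrow> real) \<Rightarrow> (real^2 \<Rightarrow> real) \<Rightarrow> real" where
  "resolvent_form lam u v = energy_form q u v + lam * (LINT z:SG q|SG_measure q. u z * v z)"

lemma resolvent_form_self:
  "u \<in> domE q \<Longrightarrow> resolvent_form lam u u = energy_lam q lam u"
  by (simp add: resolvent_form_def energy_lam_def energy_form_self energy_real_def domE_iff
      power2_eq_square)

lemma domE0_add: "u \<in> domE0 q \<Longrightarrow> v \<in> domE0 q \<Longrightarrow> (\<lambda>x. u x + v x) \<in> domE0 q"
  by (simp add: domE0_iff domE_add)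

lemma domE0_diff: "u \<in> domE0 q \<Longrightarrow> v \<in> domE0 q \<Longrightarrow> (\<lambda>x. u x - v x) \<in> domE0 q"
  by (simp add: domE0_iff domE_diff)

lemma domE0_scale: "u \<in> domE0 q \<Longrightarrow> (\<lambda>x. c * u x) \<in> domE0 q"
  by (simp add: domE0_iff domE_scale)

lemma domE0_le:
  assumes "u \<in> domE0 q"
  shows "\<bar>u x\<bar> \<le> 5 * sqrt (energy_real u)"
proof (cases "x \<in> SG q")
  case True
  then show ?thesis
    using difference_le[of u x 1] assms by (auto simp: domE0_iff domE_iff)
next
  case False
  then show ?thesis
    using assms energy_real_nonneg[of u] by (auto simp: domE0_iff domE_iff)
qed

text \<open>25 is the square of the constant in \<open>domE0_le\<close>, and the measure of the
  gasket is 1. The two norms are thus equivalent for each \<lambda>, which reduces completeness to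
  the energy alone.\<close>

lemma resolvent_form_bounds:
  assumes "u \<in> domE0 q" "lam \<ge> 0"
  shows "energy_real u \<le> resolvent_form lam u u"
    and "resolvent_form lam u u \<le> (1 + 25 * lam) * energy_real u"
proof -
  interpret prob_space "SG_measure q" by (rule prob_space_SG_measure)
  let ?I = "LINT z:SG q|SG_measure q. u z * u z"
  have u: "continuous_on (SG q) u" "energy_finite u" using assms by (auto simp: domE0_iff domE_iff)
  have eq: "resolvent_form lam u u = energy_real u + lam * ?I"
    using u by (simp add: resolvent_form_def energy_form_self)
  have "0 \<le> ?I"
    unfolding set_lebesgue_integral_def by (intro integral_nonneg_AE) auto
  then show "energy_real u \<le> resolvent_form lam u u"
    using assms by (simp add: eq)
  have "?I \<le> (LINT z:SG q|SG_measure q. 25 * energy_real u)"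
  proof (rule set_integral_mono)
    show "set_integrable (SG_measure q) (SG q) (\<lambda>z. u z * u z)"
      by (intro set_integrable_SG continuous_intros u)
    show "set_integrable (SG_measure q) (SG q) (\<lambda>z. 25 * energy_real u)"
      by (intro set_integrable_SG continuous_intros)
    fix x
    have "(\<bar>u x\<bar>)\<^sup>2 \<le> (5 * sqrt (energy_real u))\<^sup>2"
      by (intro power_mono domE0_le assms) auto
    then show "u x * u x \<le> 25 * energy_real u"
      by (simp add: power2_eq_square[symmetric] power_mult_distrib energy_real_nonneg)
  qed
  also have "\<dots> = 25 * energy_real u"
    using self_similar_measure_SG[OF SG_measure] sets_eq_imp_space_eq[OF sets_SG_measure]
    by (simp add: set_lebesgue_integral_def)
  finally have "lam * ?I \<le> lam * (25 * energy_real u)"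
    using assms(2) by (intro mult_left_mono)
  then show "resolvent_form lam u u \<le> (1 + 25 * lam) * energy_real u"
    by (simp add: eq algebra_simps)
qed

lemma domE0_complete:
  assumes s: "\<And>n :: nat. s n \<in> domE0 q"
    and cauchy: "\<And>e. e > 0 \<Longrightarrow> \<exists>N. \<forall>m\<ge>N. \<forall>n\<ge>N. energy_real (\<lambda>x. s m x - s n x) \<le> e"
  shows "\<exists>v\<in>domE0 q. (\<lambda>n. energy_real (\<lambda>x. s n x - v x)) \<longlonglongrightarrow> 0"
proof -
  have "uniformly_Cauchy_on UNIV s"
  proof (rule uniformly_Cauchy_onI)
    fix e :: real assume "e > 0"
    \<comment> \<open>With the supremum bound 5 times the root of the energy, the choice
      \<open>e/10\<close> leaves \<open>e/2\<close>, strictly below \<open>e\<close>.\<close>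
    then obtain N where N: "\<And>m n. m \<ge> N \<Longrightarrow> n \<ge> N \<Longrightarrow> energy_real (\<lambda>x. s m x - s n x) \<le> (e/10)\<^sup>2"
      using cauchy[of "(e/10)\<^sup>2"] by auto
    have "dist (s m x) (s n x) < e" if "m \<ge> N" "n \<ge> N" for m n x
    proof -
      have "\<bar>s m x - s n x\<bar> \<le> 5 * sqrt (energy_real (\<lambda>x. s m x - s n x))"
        by (rule domE0_le[OF domE0_diff[OF s s]])
      also have "\<dots> \<le> 5 * (e/10)"
        using N[OF that] \<open>e > 0\<close> by (intro mult_left_mono real_le_lsqrt) auto
      finally show ?thesis using \<open>e > 0\<close> by (simp add: dist_real_def)
    qed
    then show "\<exists>M. \<forall>x\<in>UNIV. \<forall>m\<ge>M. \<forall>n\<ge>M. dist (s m x) (s n x) < e" by blast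
  qed
  then obtain v where v: "uniform_limit UNIV s v sequentially"
    using Cauchy_uniformly_convergent uniformly_convergent_on_def by blast
  have lim: "(\<lambda>n. s n x) \<longlonglongrightarrow> v x" for x
    using tendsto_uniform_limitI[OF v] by simp
  \<comment> \<open>The limit in \<open>k\<close> is taken at a fixed level \<open>m\<close>, where
    only pointwise convergence is used; since the bound \<open>e\<close> does not depend on
    \<open>m\<close>, it passes to the full energy.\<close>
  have bound: "edge_form q m (\<lambda>x. s n x - v x) (\<lambda>x. s n x - v x) \<le> e"
    if N: "\<forall>m\<ge>N. \<forall>n\<ge>N. energy_real (\<lambda>x. s m x - s n x) \<le> e" and n: "n \<ge> N" for e N n m
  proof (rule LIMSEQ_le_const2)
    show "(\<lambda>k. edge_form q m (\<lambda>x. s n x - s k x) (\<lambda>x. s n x - s k x)) \<longlonglongrightarrow>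
        edge_form q m (\<lambda>x. s n x - v x) (\<lambda>x. s n x - v x)"
      by (rule edge_form_tendsto_pointwise) (intro tendsto_intros lim)
    have "edge_form q m (\<lambda>x. s n x - s k x) (\<lambda>x. s n x - s k x) \<le> e" if "k \<ge> N" for k
    proof -
      have "energy_finite (\<lambda>x. s n x - s k x)"
        using domE0_diff[OF s[of n] s[of k]] by (simp add: domE0_iff domE_iff)
      then show ?thesis using edge_form_le_energy N n that by (meson order_trans)
    qed
    then show "\<exists>N. \<forall>k\<ge>N. edge_form q m (\<lambda>x. s n x - s k x) (\<lambda>x. s n x - s k x) \<le> e" by blast
  qed
  have "v \<in> domE0 q"
  proof -
    obtain N where N: "\<forall>m\<ge>N. \<forall>n\<ge>N. energy_real (\<lambda>x. s m x - s n x) \<le> 1"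
      using cauchy[of 1] by auto
    \<comment> \<open>The limit inherits finite energy by being written as \<open>s N\<close> minus
      this difference.\<close>
    have "energy_finite (\<lambda>x. s N x - v x)"
      using bound[OF N, of N] by (intro energy_finiteI(1)[of _ 1]) simp
    have "energy_finite (s N)" using s[of N] by (simp add: domE0_iff domE_iff)
    from energy_finite_diff[OF this \<open>energy_finite (\<lambda>x. s N x - v x)\<close>]
    have "energy_finite (\<lambda>x. s N x - (s N x - v x))" .
    moreover have "continuous_on (SG q) v"
    proof (rule uniform_limit_theorem)
      show "uniform_limit (SG q) s v sequentially" using v by (rule uniform_limit_on_subset) simp
      show "\<forall>\<^sub>F n in sequentially. continuous_on (SG q) (s n)"
        using s by (intro always_eventually) (simp add: domE0_iff domE_iff)
    qed simp
    moreover have "v x = 0" if "x \<notin> SG q \<or> x \<in> range q" for x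
    proof -
      have "(\<lambda>n. s n x) = (\<lambda>_. 0)" using s that by (auto simp: domE0_iff domE_iff)
      then show ?thesis using lim[of x] by (simp add: LIMSEQ_const_iff)
    qed
    ultimately show ?thesis by (simp add: domE0_iff domE_iff)
  qed
  moreover have "(\<lambda>n. energy_real (\<lambda>x. s n x - v x)) \<longlonglongrightarrow> 0"
  proof (rule LIMSEQ_I)
    fix e :: real assume "e > 0"
    then obtain N where N: "\<forall>m\<ge>N. \<forall>n\<ge>N. energy_real (\<lambda>x. s m x - s n x) \<le> e / 2"
      using cauchy[of "e/2"] by auto
    have "energy_real (\<lambda>x. s n x - v x) \<le> e / 2" if "n \<ge> N" for n
      by (rule energy_finiteI(2)) (rule bound[OF N that])
    then show "\<exists>N. \<forall>n\<ge>N. norm (energy_real (\<lambda>x. s n x - v x) - 0) < e"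
      using energy_real_nonneg \<open>e > 0\<close> by (intro exI[of _ N]) fastforce
  qed
  ultimately show ?thesis by blast
qed

lemma reproducing_form_domE0:
  assumes lam: "lam \<ge> 0"
  shows "reproducing_form (domE0 q) (resolvent_form lam) 5"
proof
  have dom: "u \<in> domE0 q \<Longrightarrow> energy_finite u \<and> continuous_on (SG q) u" for u
    by (simp add: domE0_iff domE_iff)
  show "(\<lambda>_. 0) \<in> domE0 q"
    using domE0_scale[of "\<lambda>_. 0" 0] energy_finiteI(1)[of "\<lambda>_. 0" 0] edge_form_scale_left[of q _ 0 "\<lambda>_. 0" "\<lambda>_. 0"]
    by (simp add: domE0_iff domE_iff)
  show "(\<lambda>x. u x + v x) \<in> domE0 q" if "u \<in> domE0 q" "v \<in> domE0 q" for u v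
    using that by (rule domE0_add)
  show "(\<lambda>x. c * u x) \<in> domE0 q" if "u \<in> domE0 q" for u c
    using that by (rule domE0_scale)
  show "resolvent_form lam u v = resolvent_form lam v u" if "u \<in> domE0 q" "v \<in> domE0 q" for u v
    using energy_form_sym[of u v] dom that by (simp add: resolvent_form_def mult.commute)
  show "resolvent_form lam (\<lambda>x. u x + v x) w = resolvent_form lam u w + resolvent_form lam v w"
    if uvw: "u \<in> domE0 q" "v \<in> domE0 q" "w \<in> domE0 q" for u v w
  proof -
    have "(LINT z:SG q|SG_measure q. u z * w z + v z * w z) =
        (LINT z:SG q|SG_measure q. u z * w z) + (LINT z:SG q|SG_measure q. v z * w z)"
      using dom uvw by (intro set_integral_add set_integrable_SG continuous_on_mult) auto
    then show ?thesis
      using dom uvw by (simp add: resolvent_form_def energy_form_add_left distrib_left distrib_right)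
  qed
  show "resolvent_form lam (\<lambda>x. c * u x) w = c * resolvent_form lam u w"
    if "u \<in> domE0 q" "w \<in> domE0 q" for u w c
  proof -
    have "(LINT z:SG q|SG_measure q. c * u z * w z) = c * (LINT z:SG q|SG_measure q. u z * w z)"
      by (simp add: mult.assoc)
    then show ?thesis
      using dom that by (simp add: resolvent_form_def energy_form_scale_left distrib_left)
  qed
  show "0 \<le> resolvent_form lam u u" if "u \<in> domE0 q" for u
    using resolvent_form_bounds(1)[OF that lam] energy_real_nonneg[of u] by linarith
  show "\<bar>u x\<bar> \<le> 5 * sqrt (resolvent_form lam u u)" if "u \<in> domE0 q" for u x
    using domE0_le[OF that, of x] real_sqrt_le_mono[OF resolvent_form_bounds(1)[OF that lam]] by linarith
  show "\<exists>v\<in>domE0 q. (\<lambda>n. resolvent_form lam (\<lambda>x. s n x - v x) (\<lambda>x. s n x - v x)) \<longlonglongrightarrow> 0"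
    if s: "\<And>n :: nat. s n \<in> domE0 q"
      and cauchy: "\<And>e. e > 0 \<Longrightarrow>
        \<exists>N. \<forall>m\<ge>N. \<forall>n\<ge>N. resolvent_form lam (\<lambda>x. s m x - s n x) (\<lambda>x. s m x - s n x) \<le> e" for s
  proof -
    have "\<exists>N. \<forall>m\<ge>N. \<forall>n\<ge>N. energy_real (\<lambda>x. s m x - s n x) \<le> e" if e: "e > 0" for e
    proof -
      obtain N where N: "\<And>m n. m \<ge> N \<Longrightarrow> n \<ge> N \<Longrightarrow>
          resolvent_form lam (\<lambda>x. s m x - s n x) (\<lambda>x. s m x - s n x) \<le> e"
        using cauchy[OF e] by blast
      have "energy_real (\<lambda>x. s m x - s n x) \<le> e" if "m \<ge> N" "n \<ge> N" for m n
        using resolvent_form_bounds(1)[OF domE0_diff[OF s[of m] s[of n]] lam] N[OF that] by linarith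
      then show ?thesis by blast
    qed
    then obtain v where v: "v \<in> domE0 q" "(\<lambda>n. energy_real (\<lambda>x. s n x - v x)) \<longlonglongrightarrow> 0"
      using domE0_complete[of s, OF s] by blast
    have "(\<lambda>n. resolvent_form lam (\<lambda>x. s n x - v x) (\<lambda>x. s n x - v x)) \<longlonglongrightarrow> 0"
    proof (rule tendsto_sandwich[where f = "\<lambda>_. 0"
          and h = "\<lambda>n. (1 + 25 * lam) * energy_real (\<lambda>x. s n x - v x)"])
      show "(\<lambda>n. (1 + 25 * lam) * energy_real (\<lambda>x. s n x - v x)) \<longlonglongrightarrow> 0"
        using tendsto_mult_right_zero[OF v(2)] .
      show "(\<lambda>_. 0) \<longlonglongrightarrow> (0 :: real)" by simp
      show "\<forall>\<^sub>F n in sequentially. 0 \<le> resolvent_form lam (\<lambda>x. s n x - v x) (\<lambda>x. s n x - v x)"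
        by (intro always_eventually allI
            order_trans[OF energy_real_nonneg resolvent_form_bounds(1)[OF domE0_diff[OF s v(1)] lam]])
      show "\<forall>\<^sub>F n in sequentially. resolvent_form lam (\<lambda>x. s n x - v x) (\<lambda>x. s n x - v x) \<le>
          (1 + 25 * lam) * energy_real (\<lambda>x. s n x - v x)"
        using resolvent_form_bounds(2)[OF domE0_diff[OF s v(1)] lam] by (intro always_eventually allI)
    qed
    then show ?thesis using v(1) by blast
  qed
qed

end

text \<open>Nodes lie off \<open>V0\<close>: a kernel with pole at a corner is zero and every
  function in \<open>domE0 q\<close> vanishes there, so at a corner no nonzero value could be
  prescribed and the coefficient would be arbitrary.\<close>

theorem lemma2p5:
  fixes q :: "3 \<Rightarrow> real^2" and lam :: real and n :: nat
    and x :: "nat \<Rightarrow> real^2" and a :: "nat \<Rightarrow> real"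
  assumes "equilateral q"
    and "lam \<ge> 0"
    and "x ` {1..n} \<subseteq> SG q - V0 q"
    and "inj_on x {1..n}"
  shows "(\<exists>!c. c \<in> {1..n} \<rightarrow>\<^sub>E (UNIV :: real set) \<and>
            (\<forall>i\<in>{1..n}. (\<Sum>j\<in>{1..n}. c j * resolvent_kernel q lam (x i) (x j)) = a i)) \<and>
         (\<forall>c f. f = (\<lambda>y. \<Sum>j\<in>{1..n}. c j * resolvent_kernel q lam y (x j)) \<longrightarrow>
            (\<forall>i\<in>{1..n}. f (x i) = a i) \<longrightarrow>
            (\<forall>u. is_arg_min (energy_lam q lam)
                    (\<lambda>v. v \<in> domE0 q \<and> (\<forall>i\<in>{1..n}. v (x i) = a i)) u \<longleftrightarrow> u = f))"
proof -
  interpret gasket q by unfold_locales fact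
  interpret reproducing_form "domE0 q" "resolvent_form lam" 5
    by (rule reproducing_form_domE0) fact
  have kernel: "resolvent_kernel q lam y z = kernel z y" for y z
    by (simp add: resolvent_kernel_def kernel_def reproduces_def resolvent_form_def)
  have "\<forall>i\<in>{1..n}. \<exists>b. b \<in> domE0 q \<and> (\<forall>z\<in>x ` ({1..n} - {i}). b z = 0) \<and> b (x i) = 1"
  proof
    fix i assume "i \<in> {1..n}"
    then have "x i \<in> SG q - V0 q" "x i \<notin> x ` ({1..n} - {i})"
      using assms(3) inj_on_image_mem_iff[OF assms(4), of i "{1..n} - {i}"] by blast+
    moreover have "x ` ({1..n} - {i}) \<subseteq> SG q"
      using assms(3) by blast
    ultimately show "\<exists>b. b \<in> domE0 q \<and> (\<forall>z\<in>x ` ({1..n} - {i}). b z = 0) \<and> b (x i) = 1"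
      using domE0_bump[of "x ` ({1..n} - {i})" "x i"] by blast
  qed
  from bchoice[OF this] obtain b
    where b: "\<And>i. i \<in> {1..n} \<Longrightarrow> b i \<in> domE0 q"
      and "\<And>i. i \<in> {1..n} \<Longrightarrow> (\<forall>z\<in>x ` ({1..n} - {i}). b i z = 0) \<and> b i (x i) = 1"
    by blast
  then have delta: "b i (x j) = (if i = j then 1 else 0)" if "i \<in> {1..n}" "j \<in> {1..n}" for i j
    using that by auto
  \<comment> \<open>The two functionals are known to agree only on \<open>domE0 q\<close>, where the
    energy is finite; all competitors in the minimization belong to it.\<close>
  have arg_min: "is_arg_min (energy_lam q lam) P u \<longleftrightarrow> is_arg_min (\<lambda>u. resolvent_form lam u u) P u"
    if "\<And>v. P v \<Longrightarrow> v \<in> domE0 q" for P u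
  proof -
    have "energy_lam q lam v = resolvent_form lam v v" if "P v" for v
      using \<open>\<And>v. P v \<Longrightarrow> v \<in> domE0 q\<close>[OF that] by (simp add: resolvent_form_self domE0_iff)
    then show ?thesis by (auto simp: is_arg_min_def)
  qed
  show ?thesis
    unfolding kernel
  proof (intro conjI allI impI)
    show "\<exists>!c. c \<in> {1..n} \<rightarrow>\<^sub>E (UNIV :: real set) \<and>
        (\<forall>i\<in>{1..n}. (\<Sum>j\<in>{1..n}. c j * kernel (x j) (x i)) = a i)"
      by (rule interpolation(1)[of _ b]) (use b delta in auto)
    fix c f u
    assume "f = (\<lambda>y. \<Sum>j\<in>{1..n}. c j * kernel (x j) y)" "\<forall>i\<in>{1..n}. f (x i) = a i"
    then have "is_arg_min (\<lambda>u. resolvent_form lam u u)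
        (\<lambda>v. v \<in> domE0 q \<and> (\<forall>i\<in>{1..n}. v (x i) = a i)) u \<longleftrightarrow> u = f"
      by (rule interpolation(2)[of _ b, rotated 3]) (use b delta in auto)
    then show "is_arg_min (energy_lam q lam)
        (\<lambda>v. v \<in> domE0 q \<and> (\<forall>i\<in>{1..n}. v (x i) = a i)) u \<longleftrightarrow> u = f"
      by (subst arg_min) auto
  qed
qed

end
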